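(* Assume that the following conditions hold: - for $k\in K^s\cup K^u$ and $t\ge0$, $\|P^k(t)f(t,\cdot)\|_\infty\le\nu^k(t)$; - for $k\in K^s\cup K^u$, $t\ge0$ and $x,y\in X$, $|P^k(t)f(t,x)-P^k(t)f(t,y)|\le\mu^k(t)|x-y|$; - $\sum_{k\in K^s\cup K^u}\lambda_k<1$. Then: - there exists a continuous map $H\colon[0,\infty)\times X\to X$ such that if $t\mapsto x(t)$ is a solution of $x'=A(t)x$, $t\ge0$, then $t\mapsto H(t,x(t))$ is a solution of $$x'=A(t)x+\sum_{k\in K^s\cup K^u}P^k(t)f(t,x);$$ - there exists a continuous map $\bar H\colon[0,\infty)\times X\to X$ such that if $t\mapsto y(t)$ is a solution of $x'=A(t)x+f(t,x)$, $t\ge0$, then $t\mapsto\bar H(t,y(t))$ is a solution of $$x'=A(t)x+\sum_{k\in K^c}P^k(t)f(t,y(t));$$ - we have $$\sup_{t\ge0}\|H(t,\cdot)-\mathrm{Id}\|_\infty<+\infty\quad\text{and}\quad\sup_{t\ge0}\|\bar H(t,\cdot)-\mathrm{Id}\|_\infty<+\infty .$$ Moreover, in the case when $K^c=\emptyset$ or $P^k(t)f(t,\cdot)\equiv0$ for all $t\ge0$ and $k\in K^c$, the maps $H(t,\cdot)$ and $\bar H(t,\cdot)$ are homeomorphisms for each $t\ge0$ satisfying $$H(t,\bar H(t,x))=\bar H(t,H(t,x))=x,$$ $$H(t,T(t,s)x)=U(t,s)H(s,x)\quad\text{and}\quad\bar H(t,U(t,s)x)=T(t,s)\bar H(s,x)$$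 for $t,s\ge0$ and $x\in X$.
   Context: $X=(X,|\cdot|)$ is an arbitrary Banach space, $\mathcal{B}(X)$ is the space of bounded linear operators on $X$, and $\|\cdot\|$ is the operator norm on $\mathcal{B}(X)$. For a map $g\colon X\to X$, $\|g\|_\infty:=\sup\{|g(x)|:x\in X\}$. Empty sums are $0$. $A\colon[0,\infty)\to\mathcal{B}(X)$ and $f\colon[0,\infty)\times X\to X$ are continuous maps. $T(t,s)$, $t,s\ge0$, denotes the evolution family associated to the linear equation $x'=A(t)x$, $t\ge0$ (i.e. $T(t,s)v=x(t)$ where $x$ is the solution with $x(s)=v$). $U(t,s)$, $t,s\ge0$, denotes the nonlinear evolution family corresponding to the semilinear equation $x'=A(t)x+f(t,x)$, $t\ge0$, i.e. $U(t,s)v=x(t)$, where $x\colon[0,\infty)\to X$ is the solution of this equation such that $x(s)=v$; it is thus assumed that for every $s\ge0$ and $v\in X$ such a solution on $[0,\infty)$ exists and is unique. $K$ is a finite set of the form $K=K^s\cup K^u\cup K^c$ with $K^s,K^u,K^c$ pairwise disjoint. For each $t\ge0$ and $k\in K$ there is a (bounded linear) projection $P^k(t)$ on $X$ such that: $\sum_{k\in K}P^k(t)=\mathrm{Id}$; $P^k(t)P^l(t)=0$ for $k,l\in K$, $k\ne l$; and for each $k\in K$ the map $t\mapsto P^k(t)$ is measurable. There are Borel measurable functions $\mu^k,\nu^k\colon[0,\infty)\to[0,\infty)$ and numbers $\lambda_k>0$, $k\in K^s\cup K^u$, such that: - for $k\in K^s$, $$\sup_{t\ge0}\int_0^t\|T(t,s)P^k(s)\|\nu^k(s)\,ds<+\infty\quad\text{and}\quad\sup_{t\ge0}\int_0^t\|T(t,s)P^k(s)\|\mu^k(s)\,ds\le\lambda_k;$$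 - for $k\in K^u$, $$\sup_{t\ge0}\int_t^\infty\|T(t,s)P^k(s)\|\nu^k(s)\,ds<+\infty\quad\text{and}\quad\sup_{t\ge0}\int_t^\infty\|T(t,s)P^k(s)\|\mu^k(s)\,ds\le\lambda_k .$$ Since $t\mapsto P^k(t)$ is only measurable, solutions of the two equations whose right-hand sides contain the projections $P^k(t)$ are understood in the integrated (Carathéodory) sense: a continuous function $z\colon[0,\infty)\to X$ is a solution of $z'=g(t,z)$ if $z(t)=z(s)+\int_s^tg(r,z(r))\,dr$ for all $t,s\ge0$.
   Formalization: Continuity of H̄ is proved only if K^c=∅, or P^k f≡0 for all k∈K^c, or every map U(t,s): X→X is continuous; without such a condition it can fail in infinite-dimensional X. *)

theory Defs
  imports "HOL-Analysis.Analysis"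
begin

text \<open>Bochner measurability. It is stated explicitly because Borel measurability does not
  provide approximation by simple functions when the range is not separable.\<close>

definition strongly_measurable :: "'b measure \<Rightarrow> ('b \<Rightarrow> 'a::real_normed_vector) \<Rightarrow> bool" where
  "strongly_measurable M g \<longleftrightarrow>
     (\<exists>\<sigma>::nat \<Rightarrow> 'b \<Rightarrow> 'a. (\<forall>i. simple_function M (\<sigma> i)) \<and>
        (AE r in M. (\<lambda>i. \<sigma> i r) \<longlonglongrightarrow> g r))"

text \<open>The library's \<^const>\<open>has_bochner_integral\<close> is restricted to second countable
  spaces; this is the same definition without that restriction.\<close>

definition has_banach_integral ::
    "'b measure \<Rightarrow> ('b \<Rightarrow> 'a::real_normed_vector) \<Rightarrow> 'a \<Rightarrow> bool" where
  "has_banach_integral M g I \<longleftrightarrow> g \<in> borel_measurable M \<and>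
     (\<exists>\<sigma>. (\<forall>i. Bochner_Integration.simple_bochner_integrable M (\<sigma> i)) \<and>
        (\<lambda>i. \<integral>\<^sup>+r. ennreal (norm (g r - \<sigma> i r)) \<partial>M) \<longlonglongrightarrow> 0 \<and>
        (\<lambda>i. Bochner_Integration.simple_bochner_integral M (\<sigma> i)) \<longlonglongrightarrow> I)"

definition classical_solution ::
    "(real \<Rightarrow> 'a::real_normed_vector \<Rightarrow> 'a) \<Rightarrow> (real \<Rightarrow> 'a) \<Rightarrow> bool" where
  "classical_solution g x \<longleftrightarrow>
     (\<forall>t\<ge>0. (x has_vector_derivative g t (x t)) (at t within {0..}))"

text \<open>It suffices to consider \<open>s \<le> t\<close>: for \<open>t < s\<close> the oriented integral only changes sign.\<close>

definition caratheodory_solution ::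
    "(real \<Rightarrow> 'a::real_normed_vector \<Rightarrow> 'a) \<Rightarrow> (real \<Rightarrow> 'a) \<Rightarrow> bool" where
  "caratheodory_solution g z \<longleftrightarrow> continuous_on {0..} z \<and>
     (\<forall>s t. 0 \<le> s \<and> s \<le> t \<longrightarrow>
        has_banach_integral (lebesgue_on {s..t}) (\<lambda>r. g r (z r)) (z t - z s))"

definition evolution_family ::
    "(real \<Rightarrow> 'a::real_normed_vector \<Rightarrow> 'a) \<Rightarrow> (real \<Rightarrow> real \<Rightarrow> 'a \<Rightarrow> 'a) \<Rightarrow> bool" where
  "evolution_family g \<Phi> \<longleftrightarrow>
     (\<forall>s\<ge>0. \<forall>v. classical_solution g (\<lambda>t. \<Phi> t s v) \<and> \<Phi> s s v = v \<and>
        (\<forall>x. classical_solution g x \<and> x s = v \<longrightarrow> (\<forall>t\<ge>0. x t = \<Phi> t s v)))"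

definition sup_norm :: "('b \<Rightarrow> 'a::real_normed_vector) \<Rightarrow> ennreal" where
  "sup_norm g = (SUP x. ennreal (norm (g x)))"

definition center_vanishes ::
    "'k set \<Rightarrow> ('k \<Rightarrow> real \<Rightarrow> 'a::real_normed_vector \<Rightarrow>\<^sub>L 'a) \<Rightarrow> (real \<Rightarrow> 'a \<Rightarrow> 'a) \<Rightarrow> bool" where
  "center_vanishes Kc P f \<longleftrightarrow>
     Kc = {} \<or> (\<forall>t\<ge>0. \<forall>k\<in>Kc. \<forall>x. blinfun_apply (P k t) (f t x) = 0)"

end

theory Submission
  imports Defs
begin

text \<open>For a continuous curve \<open>c\<close> let
  \<open>G(c)(t) = \<Sum>\<^sub>s \<integral>\<^sub>0\<^sup>t T(t,s) P\<^sup>k(s) f(s,c(s)) ds - \<Sum>\<^sub>u \<integral>\<^sub>t\<^sup>\<infinity> T(t,s) P\<^sup>k(s) f(s,c(s)) ds\<close>.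
  The bounds on \<open>\<nu>\<close> and \<open>\<mu>\<close> make \<open>G\<close> bounded and a contraction with constant \<open>\<Sum> \<lambda>\<^sub>k < 1\<close>, and
  \<open>G(c)\<close> solves \<open>w' = A w + \<Sum> P\<^sup>k f(t,c)\<close>. Hence along a linear solution \<open>x\<close> the fixed point
  \<open>z = x + G(z)\<close> defines \<open>H(t,x(t)) = z(t)\<close>, and along a nonlinear solution \<open>y\<close> one puts
  \<open>Hbar(t,y(t)) = y(t) - G(y)(t)\<close>. If the central part of \<open>f\<close> vanishes, \<open>z\<close> and \<open>Hbar(t,y(t))\<close> are
  classical solutions, and the injectivity of \<open>c \<mapsto> c - G(c)\<close> shows that the two maps are inverse
  to each other. Banach-valued integrals are taken in the sense of Henstock and Kurzweil, which
  needs no separability, and are compared with Bochner integrals only in the final solutions.\<close>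

section \<open>Strongly measurable functions and their integrals\<close>

text \<open>The projections are only measurable and \<open>X\<close> need not be separable, so
  integrands are kept strongly measurable and dominated convergence is applied only to real-valued
  norms. The hypotheses bound \<open>P f\<close> by \<open>\<nu>\<close> but integrate the norm of
  \<open>T P\<close> against \<open>\<nu>\<close>; idempotence reconciles the two, since
  \<open>T P f = (T P) (P f)\<close>. Because \<open>T\<close> can be run backwards, the kernel
  bounds also make \<open>norm (P k s) * \<nu> k s\<close> and
  \<open>norm (P k s) * \<mu> k s\<close> locally integrable, which gives the equation for
  \<open>G(c)\<close> a meaning on bounded intervals. Trajectories with nearby initial values are
  close pointwise in time, not uniformly on \<open>{0..}\<close>. Continuity in parameters therefore
  rests on \<open>G\<close> turning pointwise convergence of curves into convergence, the dominating
  functions being independent of the curve. The two directions are not symmetric: linear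
  trajectories depend continuously on the initial value, so the fixed points for all initial values
  are found together in one space of bounded continuous functions, whereas \<open>Hbar\<close> is
  explicit but inherits its continuity from that of the nonlinear flow.\<close>

lemma strongly_measurable_compose2:
  fixes p :: "'a::real_normed_vector \<Rightarrow> 'b::real_normed_vector \<Rightarrow> 'c::real_normed_vector"
  assumes "strongly_measurable M f" "strongly_measurable M g"
    and p: "continuous_on UNIV (\<lambda>(x, y). p x y)"
  shows "strongly_measurable M (\<lambda>x. p (f x) (g x))"
proof -
  obtain \<sigma> \<tau> where \<sigma>: "\<And>i. simple_function M (\<sigma> i)" "AE r in M. (\<lambda>i. \<sigma> i r) \<longlonglongrightarrow> f r"
    and \<tau>: "\<And>i. simple_function M (\<tau> i)" "AE r in M. (\<lambda>i. \<tau> i r) \<longlonglongrightarrow> g r"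
    using assms(1,2) unfolding strongly_measurable_def by blast
  have "AE r in M. (\<lambda>i. p (\<sigma> i r) (\<tau> i r)) \<longlonglongrightarrow> p (f r) (g r)"
    using \<sigma>(2) \<tau>(2)
  proof eventually_elim
    case (elim r)
    have "(\<lambda>i. (\<sigma> i r, \<tau> i r)) \<longlonglongrightarrow> (f r, g r)"
      using elim by (rule tendsto_Pair)
    from continuous_on_tendsto_compose[OF p this] show ?case
      by simp
  qed
  \<comment> \<open>A pair of simple functions takes finitely many values, so neither measurability
    of \<open>p\<close> nor a product sigma-algebra on the range enters.\<close>
  moreover have "simple_function M (\<lambda>r. p (\<sigma> i r) (\<tau> i r))" for i
    using \<sigma>(1) \<tau>(1) by (rule simple_function_compose2)
  ultimately show ?thesis
    unfolding strongly_measurable_def by (intro exI[of _ "\<lambda>i r. p (\<sigma> i r) (\<tau> i r)"]) auto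
qed

lemma strongly_measurable_const: "strongly_measurable M (\<lambda>x. c)"
  unfolding strongly_measurable_def by (intro exI[of _ "\<lambda>i r. c"]) auto

lemma strongly_measurable_add:
  "strongly_measurable M f \<Longrightarrow> strongly_measurable M g \<Longrightarrow> strongly_measurable M (\<lambda>x. f x + g x)"
  by (rule strongly_measurable_compose2[where p="(+)"]) (auto simp: split_beta intro!: continuous_intros)

lemma strongly_measurable_sum:
  "(\<And>i. i \<in> I \<Longrightarrow> strongly_measurable M (f i)) \<Longrightarrow> strongly_measurable M (\<lambda>x. \<Sum>i\<in>I. f i x)"
  by (induction I rule: infinite_finite_induct)
    (auto intro: strongly_measurable_const strongly_measurable_add)

lemma strongly_measurable_blinfun_apply:
  "strongly_measurable M L \<Longrightarrow> strongly_measurable M f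
    \<Longrightarrow> strongly_measurable M (\<lambda>x. blinfun_apply (L x) (f x))"
  by (rule strongly_measurable_compose2[where p="blinfun_apply"])
    (auto simp: split_beta intro!: continuous_intros)

lemma strongly_measurable_blinfun_compose:
  "strongly_measurable M L \<Longrightarrow> strongly_measurable M L'
    \<Longrightarrow> strongly_measurable M (\<lambda>x. L x o\<^sub>L L' x)"
  by (rule strongly_measurable_compose2[where p="(o\<^sub>L)"])
    (auto simp: split_beta intro!: bounded_bilinear.continuous_on[OF bounded_bilinear_blinfun_compose] continuous_intros)

lemma strongly_measurable_norm:
  "strongly_measurable M f \<Longrightarrow> strongly_measurable M (\<lambda>x. norm (f x))"
  by (rule strongly_measurable_compose2[where p="\<lambda>x (y::real). norm x" and g="\<lambda>x. 0"])
    (auto simp: split_beta strongly_measurable_const intro!: continuous_intros)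

text \<open>Setting the values outside \<open>S\<close> to zero adds at most one value to a simple
  function. This lets measurability on \<open>{0..}\<close> serve every subinterval and every domain
  of integration.\<close>

lemma strongly_measurable_lebesgue_on_extend:
  fixes g :: "'b::euclidean_space \<Rightarrow> 'a::real_normed_vector"
  assumes g: "strongly_measurable (lebesgue_on S) g"
    and S: "S \<in> sets lebesgue" and R: "R \<in> sets lebesgue"
  shows "strongly_measurable (lebesgue_on R) (\<lambda>x. if x \<in> S then g x else 0)"
proof -
  obtain \<sigma> where \<sigma>: "\<And>i. simple_function (lebesgue_on S) (\<sigma> i)"
    "AE r in lebesgue_on S. (\<lambda>i. \<sigma> i r) \<longlonglongrightarrow> g r"
    using g unfolding strongly_measurable_def by blast
  define \<tau> where "\<tau> = (\<lambda>i r. if r \<in> S then \<sigma> i r else 0)"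
  have "simple_function (lebesgue_on R) (\<tau> i)" for i
    unfolding simple_function_def
  proof
    have "\<tau> i ` R \<subseteq> insert 0 (\<sigma> i ` S)"
      by (auto simp: \<tau>_def split: if_splits)
    moreover have "finite (\<sigma> i ` S)"
      using \<sigma>(1)[of i] by (simp add: simple_function_def)
    ultimately show "finite (\<tau> i ` space (lebesgue_on R))"
      by (auto intro: finite_subset)
    show "\<forall>x\<in>\<tau> i ` space (lebesgue_on R). \<tau> i -` {x} \<inter> space (lebesgue_on R) \<in> sets (lebesgue_on R)"
    proof
      fix y assume "y \<in> \<tau> i ` space (lebesgue_on R)"
      have "\<sigma> i -` {y} \<inter> space (lebesgue_on S) \<in> sets (lebesgue_on S)"
        using \<sigma>(1)[of i] by (rule simple_functionD(2))
      then have 1: "\<sigma> i -` {y} \<inter> S \<in> sets lebesgue"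
        using S by (simp add: sets_restrict_space_iff)
      have "\<tau> i -` {y} \<inter> R = (\<sigma> i -` {y} \<inter> S) \<inter> R \<union> (if y = 0 then R - S else {})"
        by (auto simp: \<tau>_def split: if_splits)
      also have "\<dots> \<in> sets lebesgue"
        using 1 S R by auto
      finally show "\<tau> i -` {y} \<inter> space (lebesgue_on R) \<in> sets (lebesgue_on R)"
        using R by (simp add: sets_restrict_space_iff)
    qed
  qed
  moreover have "AE r in lebesgue_on R. (\<lambda>i. \<tau> i r) \<longlonglongrightarrow> (if r \<in> S then g r else 0)"
  proof -
    have "AE r in lebesgue. r \<in> S \<longrightarrow> (\<lambda>i. \<sigma> i r) \<longlonglongrightarrow> g r"
      using \<sigma>(2) S by (simp add: AE_restrict_space_iff)
    then have "AE r in lebesgue. r \<in> R \<longrightarrow> (\<lambda>i. \<tau> i r) \<longlonglongrightarrow> (if r \<in> S then g r else 0)"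
      by eventually_elim (auto simp: \<tau>_def)
    then show ?thesis
      using R by (simp add: AE_restrict_space_iff)
  qed
  ultimately show ?thesis
    unfolding strongly_measurable_def by blast
qed

lemma strongly_measurable_cong:
  assumes "\<And>x. x \<in> space M \<Longrightarrow> f x = g x"
  shows "strongly_measurable M f \<longleftrightarrow> strongly_measurable M g"
  unfolding strongly_measurable_def using assms by (simp cong: AE_cong)

lemma strongly_measurable_lebesgue_on_subset:
  fixes g :: "'b::euclidean_space \<Rightarrow> 'a::real_normed_vector"
  assumes "strongly_measurable (lebesgue_on S) g"
    and "S \<in> sets lebesgue" "R \<in> sets lebesgue" "R \<subseteq> S"
  shows "strongly_measurable (lebesgue_on R) g"
  using strongly_measurable_lebesgue_on_extend[OF assms(1-3)] assms(4)
  by (subst strongly_measurable_cong[where g="\<lambda>x. if x \<in> S then g x else 0"]) auto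

text \<open>Time is discretised instead of the range: \<open>d i\<close> rounds down to the grid of
  mesh \<open>1 / i\<close> and caps at \<open>i\<close>, hence has finitely many values, and
  \<open>c\<close> composed with it is simple even if the range is not separable.\<close>

lemma strongly_measurable_continuous_on_atLeast:
  fixes c :: "real \<Rightarrow> 'a::real_normed_vector"
  assumes c: "continuous_on {0..} c"
  shows "strongly_measurable (lebesgue_on {0..}) c"
proof -
  define d where "d i r = min (real i) (of_int \<lfloor>r * real i\<rfloor> / real i)" for i :: nat and r :: real
  have lim: "(\<lambda>i. d i r) \<longlonglongrightarrow> r" if "r \<ge> 0" for r
  proof (rule real_tendsto_sandwich)
    show "\<forall>\<^sub>F i in sequentially. r - 1 / real i \<le> d i r"
    proof (rule eventually_sequentiallyI)
      fix i :: nat assume i: "nat \<lceil>r\<rceil> + 1 \<le> i"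
      then have "r \<le> real i" by linarith
      moreover have "r - 1 / real i \<le> of_int \<lfloor>r * real i\<rfloor> / real i"
      proof -
        have "r * real i - 1 \<le> of_int \<lfloor>r * real i\<rfloor>"
          by linarith
        then have "(r * real i - 1) / real i \<le> of_int \<lfloor>r * real i\<rfloor> / real i"
          by (rule divide_right_mono) simp
        then show ?thesis
          using i by (simp add: diff_divide_distrib)
      qed
      ultimately show "r - 1 / real i \<le> d i r"
        unfolding d_def by (simp add: order_trans[of _ r])
    qed
    show "\<forall>\<^sub>F i in sequentially. d i r \<le> r"
    proof (rule eventually_sequentiallyI)
      fix i :: nat assume i: "1 \<le> i"
      then have "of_int \<lfloor>r * real i\<rfloor> / real i \<le> r"
        by (simp add: field_simps)
      then show "d i r \<le> r"
        unfolding d_def by auto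
    qed
    show "(\<lambda>i. r - 1 / real i) \<longlonglongrightarrow> r"
      using tendsto_diff[OF tendsto_const lim_1_over_n, of r] by simp
  qed simp
  have d0: "d i r \<ge> 0" if "r \<ge> 0" for i r
    using that by (auto simp: d_def)
  have sf: "simple_function (lebesgue_on {0..}) (d i)" for i
  proof (rule simple_function_borel_measurable)
    have "d i \<in> borel_measurable borel"
      unfolding d_def by measurable
    then show "d i \<in> borel_measurable (lebesgue_on {0..})"
      by (simp add: borel_measurable_if_D measurable_completion measurable_restrict_space1)
    have "d i ` {0..} \<subseteq> insert (real i) ((\<lambda>k. real_of_int k / real i) ` {0..int (i*i)})"
    proof
      fix y assume "y \<in> d i ` {0..}"
      then obtain r where r: "r \<ge> 0" "y = d i r" by auto
      show "y \<in> insert (real i) ((\<lambda>k. real_of_int k / real i) ` {0..int (i*i)})"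
      proof (cases "y = real i")
        case False
        then have y: "y = of_int \<lfloor>r * real i\<rfloor> / real i" and lt: "y < real i"
          using r by (auto simp: d_def min_def split: if_splits)
        have i: "i > 0" using lt y by (cases i) auto
        have "of_int \<lfloor>r * real i\<rfloor> < real i * real i"
          using lt i unfolding y by (simp add: divide_less_eq)
        then have "\<lfloor>r * real i\<rfloor> \<le> int (i*i)"
          by (metis of_int_less_iff of_int_of_nat_eq of_nat_mult less_imp_le)
        moreover have "0 \<le> \<lfloor>r * real i\<rfloor>"
          using r by simp
        ultimately show ?thesis
          using y by auto
      qed simp
    qed
    then show "finite (d i ` space (lebesgue_on {0..}))"
      by (auto intro: finite_subset)
  qed
  show ?thesis
    unfolding strongly_measurable_def
  proof (intro exI[of _ "\<lambda>i r. c (d i r)"] conjI allI)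
    show "simple_function (lebesgue_on {0..}) (\<lambda>r. c (d i r))" for i
      using sf by (rule simple_function_compose1)
    show "AE r in lebesgue_on {0..}. (\<lambda>i. c (d i r)) \<longlonglongrightarrow> c r"
      by (rule AE_I2, rule continuous_on_tendsto_compose[OF c lim]) (auto simp: d0)
  qed
qed

text \<open>Off the exceptional null set \<open>g\<close> is a pointwise limit of simple functions;
  on that set any preimage is measurable because Lebesgue measure is complete.\<close>

lemma borel_measurable_strongly_measurable:
  fixes g :: "'b::euclidean_space \<Rightarrow> 'a::real_normed_vector"
  assumes g: "strongly_measurable (lebesgue_on S) g" and S: "S \<in> sets lebesgue"
  shows "g \<in> borel_measurable (lebesgue_on S)"
proof -
  let ?M = "lebesgue_on S"
  obtain \<sigma> where \<sigma>: "\<And>i. simple_function ?M (\<sigma> i)" "AE r in ?M. (\<lambda>i. \<sigma> i r) \<longlonglongrightarrow> g r"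
    using g unfolding strongly_measurable_def by blast
  obtain N where N: "{x \<in> space ?M. \<not> (\<lambda>i. \<sigma> i x) \<longlonglongrightarrow> g x} \<subseteq> N" "N \<in> null_sets ?M"
    using \<sigma>(2) by (auto elim!: AE_E simp: null_sets_def)
  have NS: "N \<subseteq> S" "N \<in> null_sets lebesgue"
    using N(2) S by (auto simp: null_sets_restrict_space)
  define g' where "g' x = (if x \<in> N then 0 else g x)" for x
  have g': "g' \<in> borel_measurable ?M"
  proof (rule borel_measurable_LIMSEQ_metric)
    show "(\<lambda>x. if x \<in> N then 0 else \<sigma> i x) \<in> borel_measurable ?M" for i
    proof -
      have "simple_function ?M (\<lambda>x. if x \<in> N then 0 else \<sigma> i x)"
        using N(2) \<sigma>(1)[of i] by (intro simple_function_If_set) (auto simp: null_sets_def)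
      then show ?thesis by (rule borel_measurable_simple_function)
    qed
    show "(\<lambda>i. if x \<in> N then 0 else \<sigma> i x) \<longlonglongrightarrow> g' x" if "x \<in> space ?M" for x
      using that N(1) by (auto simp: g'_def)
  qed
  show ?thesis
  proof (rule measurableI)
    fix B :: "'a set" assume B: "B \<in> sets borel"
    have "g' -` B \<inter> S \<in> sets lebesgue"
      using measurable_sets[OF g' B] S by (simp add: sets_restrict_space_iff)
    moreover have "g -` B \<inter> N \<in> sets lebesgue"
      by (rule completion.complete[OF _ NS(2)]) auto
    moreover have "N \<in> sets lebesgue"
      using NS(2) by auto
    moreover have "g -` B \<inter> S = (g' -` B \<inter> S - N) \<union> (g -` B \<inter> N)"
      using NS(1) by (auto simp: g'_def)
    ultimately have "g -` B \<inter> S \<in> sets lebesgue" by auto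
    then show "g -` B \<inter> space ?M \<in> sets ?M"
      using S by (simp add: sets_restrict_space_iff)
  qed simp
qed

section \<open>Henstock-Kurzweil and Bochner integrals of strongly measurable functions\<close>

lemma simple_function_has_integral:
  fixes \<sigma> :: "real \<Rightarrow> 'a::real_normed_vector"
  assumes \<sigma>: "simple_function (lebesgue_on {a..b}) \<sigma>"
  shows "(\<sigma> has_integral Bochner_Integration.simple_bochner_integral (lebesgue_on {a..b}) \<sigma>) {a..b}"
proof -
  let ?S = "{a..b}"
  define E where "E y = {x \<in> ?S. \<sigma> x = y}" for y
  have fin: "finite (\<sigma> ` ?S)"
    using \<sigma> by (simp add: simple_function_def)
  have E: "(indicator (E y) has_integral measure (lebesgue_on ?S) (E y)) ?S" for y
  proof -
    have "\<sigma> -` {y} \<inter> space (lebesgue_on ?S) \<in> sets (lebesgue_on ?S)"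
      using \<sigma> by (rule simple_functionD(2))
    also have "\<sigma> -` {y} \<inter> space (lebesgue_on ?S) = E y"
      by (auto simp: E_def)
    finally have Em: "E y \<in> sets lebesgue"
      by (simp add: sets_restrict_space_iff)
    have "E y \<in> lmeasurable"
      by (rule bounded_set_imp_lmeasurable[OF _ Em])
        (auto intro: bounded_subset[of ?S] simp: E_def)
    then have "(indicator (E y) has_integral measure lebesgue (E y)) UNIV"
      by (simp add: lmeasurable_iff_has_integral)
    moreover have "indicator (E y) = (\<lambda>x. if x \<in> ?S then indicator (E y) x else (0::real))"
      by (auto simp: E_def indicator_def)
    ultimately have "(indicator (E y) has_integral measure lebesgue (E y)) ?S"
      by (metis has_integral_restrict_UNIV)
    moreover have "measure (lebesgue_on ?S) (E y) = measure lebesgue (E y)"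
      by (rule measure_restrict_space) (auto simp: E_def)
    ultimately show ?thesis by simp
  qed
  have "((\<lambda>x. \<Sum>y\<in>\<sigma> ` ?S. indicat_real (E y) x *\<^sub>R y) has_integral
      (\<Sum>y\<in>\<sigma> ` ?S. measure (lebesgue_on ?S) (E y) *\<^sub>R y)) ?S"
    by (intro has_integral_sum fin has_integral_scaleR_left E)
  moreover have "(\<Sum>y\<in>\<sigma> ` ?S. indicat_real (E y) x *\<^sub>R y) = \<sigma> x" if "x \<in> ?S" for x
  proof -
    have "(\<Sum>y\<in>\<sigma> ` ?S. indicat_real (E y) x *\<^sub>R y) = (\<Sum>y\<in>\<sigma> ` ?S. if \<sigma> x = y then y else 0)"
      using that by (intro sum.cong) (auto simp: E_def)
    also have "\<dots> = \<sigma> x"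
      using fin that by simp
    finally show ?thesis .
  qed
  ultimately have "(\<sigma> has_integral (\<Sum>y\<in>\<sigma> ` ?S. measure (lebesgue_on ?S) (E y) *\<^sub>R y)) ?S"
    by (rule has_integral_eq[rotated])
  then show ?thesis
    by (simp add: Bochner_Integration.simple_bochner_integral_def E_def)
qed

text \<open>A Riemann sum of \<open>g - \<phi>\<close> is bounded in norm by the Riemann sum of
  \<open>norm (g x - \<phi> x)\<close>, a real function whose integral is small. So the Cauchy
  criterion passes from \<open>\<phi>\<close> to \<open>g\<close>.\<close>

lemma integrable_on_L1_limit:
  fixes g :: "'n::euclidean_space \<Rightarrow> 'a::banach"
  assumes approx: "\<And>e. e > 0 \<Longrightarrow> \<exists>\<phi>. \<phi> integrable_on cbox a b
      \<and> (\<lambda>x. norm (g x - \<phi> x)) integrable_on cbox a b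
      \<and> integral (cbox a b) (\<lambda>x. norm (g x - \<phi> x)) < e"
  shows "g integrable_on cbox a b"
  unfolding integrable_Cauchy
proof (intro allI impI)
  fix e :: real assume e: "e > 0"
  let ?\<Sigma> = "\<lambda>\<D> h. \<Sum>(x,K)\<in>\<D>. measure lborel K *\<^sub>R h x"
  obtain \<phi> where \<phi>: "\<phi> integrable_on cbox a b"
    and n: "(\<lambda>x. norm (g x - \<phi> x)) integrable_on cbox a b"
    and I: "integral (cbox a b) (\<lambda>x. norm (g x - \<phi> x)) < e / 6"
    \<comment> \<open>One \<open>e / 6\<close> for the integral of the error and one for its Riemann
      sum give \<open>e / 3\<close> for each of the two divisions; the Cauchy estimate for
      \<open>\<phi>\<close> takes the last \<open>e / 3\<close>.\<close>
    using approx[of "e / 6"] e by auto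
  have "e / 3 > 0" "e / 6 > 0"
    using e by auto
  from \<phi>[unfolded integrable_Cauchy, THEN spec, THEN mp, OF \<open>e / 3 > 0\<close>]
  obtain \<gamma>1 where \<gamma>1: "gauge \<gamma>1"
    "\<forall>\<D>1 \<D>2. \<D>1 tagged_division_of (cbox a b) \<and> \<gamma>1 fine \<D>1 \<and>
      \<D>2 tagged_division_of (cbox a b) \<and> \<gamma>1 fine \<D>2 \<longrightarrow> norm (?\<Sigma> \<D>1 \<phi> - ?\<Sigma> \<D>2 \<phi>) < e / 3"
    by (elim exE conjE) (rule that)
  from n[THEN integrable_integral, unfolded has_integral, THEN spec, THEN mp, OF \<open>e / 6 > 0\<close>]
  obtain \<gamma>2 where \<gamma>2: "gauge \<gamma>2"
    "\<forall>\<D>. \<D> tagged_division_of (cbox a b) \<and> \<gamma>2 fine \<D> \<longrightarrow>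
      norm (?\<Sigma> \<D> (\<lambda>x. norm (g x - \<phi> x)) - integral (cbox a b) (\<lambda>x. norm (g x - \<phi> x))) < e / 6"
    by (elim exE conjE) (rule that)
  have close: "norm (?\<Sigma> \<D> g - ?\<Sigma> \<D> \<phi>) < e / 3"
    if \<D>: "\<D> tagged_division_of (cbox a b)" "\<gamma>2 fine \<D>" for \<D>
  proof -
    have "?\<Sigma> \<D> g - ?\<Sigma> \<D> \<phi> = ?\<Sigma> \<D> (\<lambda>x. g x - \<phi> x)"
      by (simp add: sum_subtractf[symmetric] split_beta scaleR_diff_right)
    also have "norm \<dots> \<le> ?\<Sigma> \<D> (\<lambda>x. norm (g x - \<phi> x))"
      by (rule sum_norm_le) (auto simp: split_beta)
    also have "\<dots> < e / 3"
      using \<gamma>2(2)[rule_format, OF conjI[OF \<D>]] I unfolding real_norm_def abs_less_iff by linarith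
    finally show ?thesis .
  qed
  have tri: "norm (x - y) < e" if "norm (p - q) < e / 3" "norm (x - p) < e / 3" "norm (y - q) < e / 3"
    for x y p q :: 'a
    using that by norm
  show "\<exists>\<gamma>. gauge \<gamma> \<and> (\<forall>\<D>1 \<D>2. \<D>1 tagged_division_of (cbox a b) \<and> \<gamma> fine \<D>1 \<and>
      \<D>2 tagged_division_of (cbox a b) \<and> \<gamma> fine \<D>2 \<longrightarrow> norm (?\<Sigma> \<D>1 g - ?\<Sigma> \<D>2 g) < e)"
  proof (intro exI[of _ "\<lambda>x. \<gamma>1 x \<inter> \<gamma>2 x"] conjI allI impI gauge_Int \<gamma>1(1) \<gamma>2(1))
    fix \<D>1 \<D>2
    assume *: "\<D>1 tagged_division_of cbox a b \<and> (\<lambda>x. \<gamma>1 x \<inter> \<gamma>2 x) fine \<D>1 \<and>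
       \<D>2 tagged_division_of cbox a b \<and> (\<lambda>x. \<gamma>1 x \<inter> \<gamma>2 x) fine \<D>2"
    then have "norm (?\<Sigma> \<D>1 \<phi> - ?\<Sigma> \<D>2 \<phi>) < e / 3"
      by (intro \<gamma>1(2)[rule_format]) (auto simp: fine_Int)
    moreover have "norm (?\<Sigma> \<D>1 g - ?\<Sigma> \<D>1 \<phi>) < e / 3"
      by (rule close) (use * in \<open>simp_all add: fine_Int\<close>)
    moreover have "norm (?\<Sigma> \<D>2 g - ?\<Sigma> \<D>2 \<phi>) < e / 3"
      by (rule close) (use * in \<open>simp_all add: fine_Int\<close>)
    ultimately show "norm (?\<Sigma> \<D>1 g - ?\<Sigma> \<D>2 g) < e"
      by (rule tri)
  qed
qed

text \<open>Simple approximations are truncated so that the error is dominated; its integral then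
  tends to zero, which serves both as the hypothesis of \<open>integrable_on_L1_limit\<close> and as
  the approximation in \<open>has_banach_integral\<close>. The two integrals agree because they
  agree on simple functions.\<close>

lemma strongly_measurable_integrable_interval:
  fixes g :: "real \<Rightarrow> 'a::banach"
  assumes g: "strongly_measurable (lebesgue_on {a..b}) g"
    and h: "h integrable_on {a..b}" and bound: "\<And>x. x \<in> {a..b} \<Longrightarrow> norm (g x) \<le> h x"
  shows "g integrable_on {a..b}"
    and "has_banach_integral (lebesgue_on {a..b}) g (integral {a..b} g)"
proof -
  let ?M = "lebesgue_on {a..b}"
  have gm: "g \<in> borel_measurable ?M"
    using g by (rule borel_measurable_strongly_measurable) simp
  have h_abs: "h absolutely_integrable_on {a..b}"
    using h bound by (intro nonnegative_absolutely_integrable_1) (auto intro: order_trans[OF norm_ge_zero])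
  then have h_int: "integrable ?M h"
    by (simp add: integrable_restrict_space set_integrable_def)
  obtain \<sigma> where \<sigma>: "\<And>i. simple_function ?M (\<sigma> i)" "AE r in ?M. (\<lambda>i. \<sigma> i r) \<longlonglongrightarrow> g r"
    using g unfolding strongly_measurable_def by blast
  \<comment> \<open>The factor 2 leaves room: where \<open>g r\<close> is nonzero the truncation is
    eventually inactive, and where \<open>g r = 0\<close> it forces the value 0. In both cases the
    limit survives, and the error is at most \<open>3 * h r\<close>.\<close>
  define \<tau> where "\<tau> i r = (if norm (\<sigma> i r) \<le> 2 * norm (g r) then \<sigma> i r else 0)" for i r
  have \<tau>: "simple_function ?M (\<tau> i)" for i
  proof -
    have [measurable]: "\<sigma> i \<in> borel_measurable ?M" "g \<in> borel_measurable ?M"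
      using \<sigma>(1) gm by (auto intro: borel_measurable_simple_function)
    have "{x \<in> space ?M. norm (\<sigma> i x) \<le> 2 * norm (g x)} \<in> sets ?M"
      by measurable
    then have "simple_function ?M (\<lambda>x. if x \<in> {x \<in> space ?M. norm (\<sigma> i x) \<le> 2 * norm (g x)} then \<sigma> i x else 0)"
      using \<sigma>(1)[of i] by (intro simple_function_If_set) auto
    then show ?thesis
      by (subst simple_function_cong) (auto simp: \<tau>_def)
  qed
  have \<tau>_lim: "AE r in ?M. (\<lambda>i. \<tau> i r) \<longlonglongrightarrow> g r"
    using \<sigma>(2)
  proof eventually_elim
    case (elim r)
    show ?case
    proof (cases "g r = 0")
      case True
      then have "\<tau> i r = 0" for i
        by (auto simp: \<tau>_def)
      then show ?thesis using True by simp
    next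
      case False
      have "(\<lambda>i. norm (\<sigma> i r)) \<longlonglongrightarrow> norm (g r)"
        using elim by (rule tendsto_norm)
      then have "\<forall>\<^sub>F i in sequentially. norm (\<sigma> i r) < 2 * norm (g r)"
        using False by (intro order_tendstoD(2)) auto
      then have "\<forall>\<^sub>F i in sequentially. \<sigma> i r = \<tau> i r"
        by eventually_elim (simp add: \<tau>_def)
      with elim show ?thesis by (rule Lim_transform_eventually)
    qed
  qed
  have \<tau>_bound: "norm (g r - \<tau> i r) \<le> 3 * h r" if "r \<in> {a..b}" for i r
  proof -
    have "norm (\<tau> i r) \<le> 2 * norm (g r)"
      by (simp add: \<tau>_def)
    then show ?thesis
      using bound[OF that] norm_triangle_ineq4[of "g r" "\<tau> i r"] by linarith
  qed
  define e where "e i r = norm (g r - \<tau> i r)" for i r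
  have e_meas: "e i \<in> borel_measurable ?M" for i
  proof (rule borel_measurable_strongly_measurable)
    have "strongly_measurable ?M (\<tau> i)"
      unfolding strongly_measurable_def using \<tau>[of i] by (intro exI[of _ "\<lambda>_. \<tau> i"]) auto
    then show "strongly_measurable ?M (e i)"
      unfolding e_def
      by (rule strongly_measurable_compose2[OF g, where p="\<lambda>x y. norm (x - y)"])
        (auto simp: split_beta intro!: continuous_intros)
  qed simp
  have e_int: "integrable ?M (e i)" for i
  proof (rule Bochner_Integration.integrable_bound[of _ "\<lambda>r. 3 * h r"])
    show "AE x in ?M. norm (e i x) \<le> norm (3 * h x)"
      using \<tau>_bound by (intro AE_I2) (auto simp: e_def intro: order_trans[OF _ abs_ge_self])
  qed (use h_int e_meas in auto)
  have e_HK: "e i integrable_on {a..b}" for i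
    using e_int by (rule integrable_on_lebesgue_on) simp
  have e_eq: "integral\<^sup>L ?M (e i) = integral {a..b} (e i)" for i
    using e_int by (rule lebesgue_integral_eq_integral) simp
  have "(\<lambda>i. integral\<^sup>L ?M (e i)) \<longlonglongrightarrow> integral\<^sup>L ?M (\<lambda>r. 0::real)"
  proof (rule integral_dominated_convergence[where w="\<lambda>r. 3 * h r"])
    show "AE r in ?M. (\<lambda>i. e i r) \<longlonglongrightarrow> 0"
      using \<tau>_lim
    proof eventually_elim
      case (elim r)
      from tendsto_norm[OF tendsto_diff[OF tendsto_const elim, of "g r"]] show ?case
        by (simp add: e_def)
    qed
    show "AE r in ?M. norm (e i r) \<le> 3 * h r" for i
      using \<tau>_bound by (intro AE_I2) (auto simp: e_def)
  qed (use h_int e_meas in auto)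
  then have e_lim: "(\<lambda>i. integral {a..b} (e i)) \<longlonglongrightarrow> 0"
    by (simp add: e_eq)
  have \<tau>_HK: "(\<tau> i has_integral Bochner_Integration.simple_bochner_integral ?M (\<tau> i)) {a..b}" for i
    using \<tau> by (rule simple_function_has_integral)
  have "g integrable_on cbox a b"
  proof (rule integrable_on_L1_limit)
    fix \<epsilon> :: real assume "\<epsilon> > 0"
    then obtain i where "integral {a..b} (e i) < \<epsilon>"
      using order_tendstoD(2)[OF e_lim] eventually_happens[of _ sequentially]
      by (metis sequentially_bot)
    then show "\<exists>\<phi>. \<phi> integrable_on cbox a b \<and> (\<lambda>x. norm (g x - \<phi> x)) integrable_on cbox a b
        \<and> integral (cbox a b) (\<lambda>x. norm (g x - \<phi> x)) < \<epsilon>"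
      using \<tau>_HK[of i] e_HK[of i] by (intro exI[of _ "\<tau> i"]) (auto simp: e_def[abs_def])
  qed
  then show g_HK: "g integrable_on {a..b}"
    by simp
  show "has_banach_integral ?M g (integral {a..b} g)"
    unfolding has_banach_integral_def
  proof (intro conjI gm exI[of _ \<tau>] allI)
    show "Bochner_Integration.simple_bochner_integrable ?M (\<tau> i)" for i
    proof
      show "simple_function ?M (\<tau> i)" by (rule \<tau>)
      have "emeasure ?M {y \<in> space ?M. \<tau> i y \<noteq> 0} \<le> emeasure ?M (space ?M)"
        by (rule emeasure_space)
      also have "\<dots> < \<infinity>"
        by (simp add: emeasure_restrict_space emeasure_lborel_Icc_eq)
      finally show "emeasure ?M {y \<in> space ?M. \<tau> i y \<noteq> 0} \<noteq> \<infinity>" by simp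
    qed
    have "(\<integral>\<^sup>+ r. ennreal (norm (g r - \<tau> i r)) \<partial>?M) = ennreal (integral {a..b} (e i))" for i
      using nn_integral_eq_integral[OF e_int[of i]] by (simp add: e_eq) (simp add: e_def)
    then show "(\<lambda>i. \<integral>\<^sup>+ r. ennreal (norm (g r - \<tau> i r)) \<partial>?M) \<longlonglongrightarrow> 0"
      using tendsto_ennrealI[OF e_lim] by simp
    have "norm (Bochner_Integration.simple_bochner_integral ?M (\<tau> i) - integral {a..b} g)
        \<le> integral {a..b} (e i)" for i
    proof -
      have "integral {a..b} (\<lambda>r. g r - \<tau> i r)
          = integral {a..b} g - Bochner_Integration.simple_bochner_integral ?M (\<tau> i)"
        using g_HK \<tau>_HK[of i] by (simp add: integral_diff has_integral_integrable integral_unique)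
      moreover have "norm (integral {a..b} (\<lambda>r. g r - \<tau> i r)) \<le> integral {a..b} (e i)"
        using g_HK \<tau>_HK[of i] e_HK[of i]
        by (intro integral_norm_bound_integral integrable_diff) (auto simp: e_def)
      ultimately show ?thesis by (simp add: norm_minus_commute)
    qed
    then show "(\<lambda>i. Bochner_Integration.simple_bochner_integral ?M (\<tau> i)) \<longlonglongrightarrow> integral {a..b} g"
      by (intro LIM_zero_cancel[OF Lim_null_comparison[OF _ e_lim]]) auto
  qed
qed

lemma strongly_measurable_integrable_on:
  fixes g :: "real \<Rightarrow> 'a::banach"
  assumes g: "strongly_measurable (lebesgue_on S) g" and S: "S \<in> sets lebesgue"
    and h: "h integrable_on S" and bound: "\<And>x. x \<in> S \<Longrightarrow> norm (g x) \<le> h x"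
  shows "g integrable_on S"
proof (rule integrable_on_all_intervals_integrable_bound[OF _ bound h])
  fix a b :: real
  have "(\<lambda>x. if x \<in> S then g x else 0) integrable_on {a..b}"
  proof (rule strongly_measurable_integrable_interval)
    show "strongly_measurable (lebesgue_on {a..b}) (\<lambda>x. if x \<in> S then g x else 0)"
      by (rule strongly_measurable_lebesgue_on_extend[OF g S]) simp
    show "(\<lambda>x. if x \<in> S then h x else 0) integrable_on {a..b}"
      using integrable_altD(1)[OF h, of a b] by simp
  qed (use bound in auto)
  then show "(\<lambda>x. if x \<in> S then g x else 0) integrable_on cbox a b"
    by simp
qed

section \<open>Linear evolution families\<close>

lemma continuous_on_atLeast_if_Icc:
  fixes F :: "real \<Rightarrow> 'a::topological_space"
  assumes "\<And>N. 0 \<le> N \<Longrightarrow> continuous_on {0..N} F"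
  shows "continuous_on {0..} F"
  unfolding continuous_on_eq_continuous_within
proof
  fix x :: real assume x: "x \<in> {0..}"
  have "at x within {0..} = at x within {0..x+1}"
    by (rule at_within_nhd[of x "{..<x+1}"]) (use x in auto)
  moreover have "continuous (at x within {0..x+1}) F"
    using assms[of "x+1"] x by (simp add: continuous_on_eq_continuous_within)
  ultimately show "continuous (at x within {0..}) F"
    by (simp add: continuous_within)
qed

lemma classical_solution_has_integral:
  fixes x :: "real \<Rightarrow> 'a::banach"
  assumes "classical_solution g x" "0 \<le> s" "s \<le> t"
  shows "((\<lambda>r. g r (x r)) has_integral (x t - x s)) {s..t}"
proof (rule fundamental_theorem_of_calculus)
  fix r assume "r \<in> {s..t}"
  then have "(x has_vector_derivative g r (x r)) (at r within {0..})"
    using assms by (simp add: classical_solution_def)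
  then show "(x has_vector_derivative g r (x r)) (at r within {s..t})"
    by (rule has_vector_derivative_within_subset) (use assms in auto)
qed fact

lemma classical_solution_continuous:
  "classical_solution g x \<Longrightarrow> continuous_on {0..} x"
  unfolding classical_solution_def continuous_on_eq_continuous_within
  by (auto intro: has_vector_derivative_continuous)

lemma classical_solutionI:
  fixes z :: "real \<Rightarrow> 'a::banach"
  assumes cont: "continuous_on {0..} (\<lambda>r. g r (z r))"
    and int: "\<And>s t. 0 \<le> s \<Longrightarrow> s \<le> t \<Longrightarrow> ((\<lambda>r. g r (z r)) has_integral (z t - z s)) {s..t}"
  shows "classical_solution g z"
  unfolding classical_solution_def
proof (intro allI impI)
  fix t :: real assume t: "0 \<le> t"
  let ?I = "\<lambda>u. integral {0..u} (\<lambda>r. g r (z r))"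
  have "(?I has_vector_derivative g t (z t)) (at t within {0..t+1})"
    by (rule integral_has_vector_derivative) (use t in \<open>auto intro: continuous_on_subset[OF cont]\<close>)
  then have I: "((\<lambda>u. z 0 + ?I u) has_vector_derivative g t (z t)) (at t within {0..t+1})"
    by (auto intro!: derivative_eq_intros)
  have zI: "z u = z 0 + ?I u" if "u \<in> {0..t+1}" for u
    using int[of 0 u] that by (simp add: integral_unique)
  have "(z has_vector_derivative g t (z t)) (at t within {0..t+1})"
    by (rule has_vector_derivative_transform[OF _ zI I]) (use t in auto)
  moreover have "at t within {0..} = at t within {0..t+1}"
    by (rule at_within_nhd[of t "{..<t+1}"]) (use t in auto)
  ultimately show "(z has_vector_derivative g t (z t)) (at t within {0..})"
    by simp
qed

lemma caratheodory_solutionI: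
  fixes z :: "real \<Rightarrow> 'a::banach"
  assumes "continuous_on {0..} z"
    and meas: "strongly_measurable (lebesgue_on {0..}) (\<lambda>r. g r (z r))"
    and h: "\<And>N. 0 \<le> N \<Longrightarrow> h integrable_on {0..N}" "\<And>r. 0 \<le> r \<Longrightarrow> norm (g r (z r)) \<le> h r"
    and int: "\<And>s t. 0 \<le> s \<Longrightarrow> s \<le> t \<Longrightarrow> ((\<lambda>r. g r (z r)) has_integral (z t - z s)) {s..t}"
  shows "caratheodory_solution g z"
  unfolding caratheodory_solution_def
proof (intro conjI allI impI)
  fix s t :: real assume st: "0 \<le> s \<and> s \<le> t"
  have "has_banach_integral (lebesgue_on {s..t}) (\<lambda>r. g r (z r)) (integral {s..t} (\<lambda>r. g r (z r)))"
  proof (rule strongly_measurable_integrable_interval)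
    show "strongly_measurable (lebesgue_on {s..t}) (\<lambda>r. g r (z r))"
      by (rule strongly_measurable_lebesgue_on_subset[OF meas]) (use st in auto)
    show "h integrable_on {s..t}"
      by (rule integrable_on_subinterval[OF h(1)[of t]]) (use st in auto)
  qed (use h(2) st in auto)
  moreover have "integral {s..t} (\<lambda>r. g r (z r)) = z t - z s"
    using int st by (intro integral_unique) auto
  ultimately show "has_banach_integral (lebesgue_on {s..t}) (\<lambda>r. g r (z r)) (z t - z s)"
    by simp
qed fact

text \<open>On a piece where \<open>L\<close> oscillates by less than 1/2, the maximum of
  \<open>norm (x r)\<close> exceeds the value at any point of the piece by at most half of itself,
  so it is at most twice that value. Chaining \<open>n\<close> pieces gives the factor
  \<open>2 ^ n\<close>. The constant depends on \<open>L\<close> alone, which later yields operator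
  norms and Lipschitz constants, and the argument works in both time directions.\<close>

lemma gronwall_two_sided:
  fixes L :: "real \<Rightarrow> real"
  assumes L: "continuous_on {a..b} L"
  shows "\<exists>C>0. \<forall>x::real \<Rightarrow> 'a::real_normed_vector. continuous_on {a..b} x \<longrightarrow>
      (\<forall>s t B. a \<le> s \<longrightarrow> s \<le> t \<longrightarrow> t \<le> b \<longrightarrow> (\<forall>r\<in>{s..t}. norm (x r) \<le> B)
        \<longrightarrow> norm (x t - x s) \<le> (L t - L s) * B) \<longrightarrow>
      (\<forall>s\<in>{a..b}. \<forall>t\<in>{a..b}. norm (x t) \<le> C * norm (x s))"
proof -
  have "uniformly_continuous_on {a..b} L"
    using L by (rule compact_uniformly_continuous) simp
  then obtain \<delta> where \<delta>: "\<delta> > 0"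
    "\<And>s t. s \<in> {a..b} \<Longrightarrow> t \<in> {a..b} \<Longrightarrow> dist t s < \<delta> \<Longrightarrow> dist (L t) (L s) < 1 / 2"
    unfolding uniformly_continuous_on_def by (meson half_gt_zero zero_less_one)
  \<comment> \<open>With \<open>n\<close> equal steps between any two points of
    \<open>{a..b}\<close>, each step is shorter than \<open>\<delta>\<close>.\<close>
  obtain n :: nat where n: "(b - a) / \<delta> < real n"
    using reals_Archimedean2 by blast
  have n_bound: "b - a < real n * \<delta>"
    using n \<delta>(1) by (simp add: divide_less_eq)
  show ?thesis
  proof (intro exI[of _ "2 ^ n"] conjI allI impI ballI)
    show "(0::real) < 2 ^ n" by simp
    fix x :: "real \<Rightarrow> 'a" and s t
    assume x: "continuous_on {a..b} x"
      and inc: "\<forall>s t B. a \<le> s \<longrightarrow> s \<le> t \<longrightarrow> t \<le> b \<longrightarrow> (\<forall>r\<in>{s..t}. norm (x r) \<le> B)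
        \<longrightarrow> norm (x t - x s) \<le> (L t - L s) * B"
      and s: "s \<in> {a..b}" and t: "t \<in> {a..b}"
    have local: "norm (x q) \<le> 2 * norm (x p)"
      if p: "p \<in> {a..b}" and q: "q \<in> {a..b}" and d: "\<bar>q - p\<bar> < \<delta>" for p q
    proof -
      let ?I = "{min p q..max p q}"
      have sub: "?I \<subseteq> {a..b}" using p q by auto
      have "continuous_on ?I (\<lambda>r. norm (x r))"
        using x sub by (intro continuous_on_norm) (rule continuous_on_subset)
      \<comment> \<open>The increment from \<open>p\<close> is estimated at the point where the norm
        is largest, so that the bound \<open>B\<close> is attained and can be absorbed;
        \<open>r0\<close> may lie on either side of \<open>p\<close>.\<close>
      then obtain r0 where r0: "r0 \<in> ?I" "\<And>r. r \<in> ?I \<Longrightarrow> norm (x r) \<le> norm (x r0)"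
        using continuous_attains_sup[of ?I "\<lambda>r. norm (x r)"] by (auto simp: min_le_iff_disj)
      have "norm (x (max p r0) - x (min p r0)) \<le> (L (max p r0) - L (min p r0)) * norm (x r0)"
        by (rule inc[rule_format]) (use r0 sub p in \<open>auto simp: min_def max_def split: if_splits\<close>)
      moreover have "L (max p r0) - L (min p r0) \<le> 1 / 2"
      proof -
        have "dist (L (max p r0)) (L (min p r0)) < 1 / 2"
          by (rule \<delta>(2)) (use r0(1) sub p d in \<open>auto simp: dist_real_def min_def max_def split: if_splits\<close>)
        then show ?thesis unfolding dist_real_def by linarith
      qed
      ultimately have "norm (x (max p r0) - x (min p r0)) \<le> 1 / 2 * norm (x r0)"
        by (meson mult_right_mono norm_ge_zero order_trans)
      then have "norm (x r0 - x p) \<le> 1 / 2 * norm (x r0)"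
        by (auto simp: min_def max_def norm_minus_commute split: if_splits)
      then have "norm (x r0) \<le> 2 * norm (x p)"
        using norm_triangle_ineq2[of "x r0" "x p"] by linarith
      with r0(2)[of q] show ?thesis by simp
    qed
    define p where "p i = s + (real i / real n) * (t - s)" for i
    have p_step: "norm (x (p i)) \<le> 2 ^ i * norm (x s)" if "i \<le> n" for i
      using that
    proof (induction i)
      case 0
      then show ?case by (simp add: p_def)
    next
      case (Suc i)
      have p_in: "p j \<in> {a..b}" if "j \<le> n" for j
      proof -
        have c: "0 \<le> real j / real n" "real j / real n \<le> 1"
          using that by (auto simp: divide_le_eq)
        have "p j = (1 - real j / real n) * s + (real j / real n) * t"
          unfolding p_def by algebra
        then show ?thesis
          using c s t convex_bound_le[of s b t "1 - real j / real n" "real j / real n"]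
            convex_bound_le[of "- s" "- a" "- t" "1 - real j / real n" "real j / real n"] by auto
      qed
      have "p (Suc i) - p i = (t - s) / real n"
        using Suc.prems by (simp add: p_def field_simps)
      moreover have "\<bar>(t - s) / real n\<bar> < \<delta>"
      proof -
        have "\<bar>t - s\<bar> < real n * \<delta>" using s t n_bound by auto
        then show ?thesis using Suc.prems by (simp add: field_simps)
      qed
      ultimately have "norm (x (p (Suc i))) \<le> 2 * norm (x (p i))"
        using Suc.prems by (intro local p_in) auto
      with Suc show ?case by simp
    qed
    show "norm (x t) \<le> 2 ^ n * norm (x s)"
    \<comment> \<open>For \<open>n = 0\<close> the bound on \<open>n\<close> forces
      \<open>b < a\<close>, which contradicts \<open>s\<close> lying in
      \<open>{a..b}\<close>.\<close>
    proof (cases "n = 0")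
      case True
      then show ?thesis using n_bound s by simp
    next
      case False
      then show ?thesis using p_step[of n] by (simp add: p_def)
    qed
  qed
qed

text \<open>After division by \<open>t - s\<close> the bound \<open>K * (M t - M s)\<close> remains
  and vanishes by continuity of \<open>M\<close>. With \<open>M\<close> the primitive of an
  integrable function, this replaces differentiation of that primitive.\<close>

lemma constant_if_superlinear_increments:
  fixes u :: "real \<Rightarrow> 'a::real_normed_vector"
  assumes inc: "\<And>s t. a \<le> s \<Longrightarrow> s \<le> t \<Longrightarrow> t \<le> b \<Longrightarrow> norm (u t - u s) \<le> K * (t - s) * (M t - M s)"
    and M: "continuous_on {a..b} M" and "a \<le> b"
  shows "u b = u a"
proof -
  have "(u has_derivative (\<lambda>h. 0)) (at s within {a..b})" if s: "s \<in> {a..b}" for s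
    unfolding has_derivative_within
  proof (intro conjI bounded_linear_zero, rule Lim_null_comparison)
    show "((\<lambda>t. \<bar>K\<bar> * \<bar>M t - M s\<bar>) \<longlongrightarrow> 0) (at s within {a..b})"
    proof -
      have "(M \<longlongrightarrow> M s) (at s within {a..b})"
        using M s by (simp add: continuous_on)
      then have "((\<lambda>t. \<bar>K\<bar> * \<bar>M t - M s\<bar>) \<longlongrightarrow> \<bar>K\<bar> * \<bar>M s - M s\<bar>) (at s within {a..b})"
        by (intro tendsto_intros)
      then show ?thesis by simp
    qed
    show "\<forall>\<^sub>F t in at s within {a..b}. norm ((1 / norm (t - s)) *\<^sub>R (u t - (u s + 0))) \<le> \<bar>K\<bar> * \<bar>M t - M s\<bar>"
      unfolding eventually_at_filter
    proof (intro always_eventually allI impI)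
      fix t assume t: "t \<noteq> s" "t \<in> {a..b}"
      have "norm (u t - u s) \<le> \<bar>K\<bar> * \<bar>M t - M s\<bar> * \<bar>t - s\<bar>"
      proof (cases "s \<le> t")
        case True
        then have "norm (u t - u s) \<le> K * (t - s) * (M t - M s)"
          using inc s t by auto
        also have "\<dots> \<le> \<bar>K * (t - s) * (M t - M s)\<bar>" by (rule abs_ge_self)
        finally show ?thesis by (simp add: abs_mult mult_ac)
      next
        case False
        then have "norm (u s - u t) \<le> K * (s - t) * (M s - M t)"
          using inc s t by auto
        also have "\<dots> \<le> \<bar>K * (s - t) * (M s - M t)\<bar>" by (rule abs_ge_self)
        finally show ?thesis by (simp add: abs_mult mult_ac norm_minus_commute abs_minus_commute)
      qed
      then show "norm ((1 / norm (t - s)) *\<^sub>R (u t - (u s + 0))) \<le> \<bar>K\<bar> * \<bar>M t - M s\<bar>"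
        using t(1) by (simp add: divide_le_eq)
    qed
  qed
  then have "\<exists>c. \<forall>s\<in>{a..b}. u s = c"
    by (intro has_derivative_zero_constant) auto
  then show ?thesis
    using \<open>a \<le> b\<close> by auto
qed

locale linear_evolution =
  fixes A :: "real \<Rightarrow> 'a::banach \<Rightarrow>\<^sub>L 'a"
    and T :: "real \<Rightarrow> real \<Rightarrow> 'a \<Rightarrow>\<^sub>L 'a"
  assumes A_cont: "continuous_on {0..} A"
    and T: "evolution_family (\<lambda>t x. blinfun_apply (A t) x) (\<lambda>t s v. blinfun_apply (T t s) v)"
begin

section \<open>Cocycle identity and norm continuity of the linear evolution\<close>

lemma T_solution: "s \<ge> 0 \<Longrightarrow> classical_solution (\<lambda>t x. blinfun_apply (A t) x) (\<lambda>t. blinfun_apply (T t s) v)"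
  using T by (simp add: evolution_family_def)

lemma T_refl: "s \<ge> 0 \<Longrightarrow> T s s = id_blinfun"
  using T by (intro blinfun_eqI) (simp add: evolution_family_def)

lemma solution_eq_T:
  "classical_solution (\<lambda>t x. blinfun_apply (A t) x) x \<Longrightarrow> s \<ge> 0 \<Longrightarrow> t \<ge> 0 \<Longrightarrow> x t = blinfun_apply (T t s) (x s)"
  using T by (simp add: evolution_family_def)

text \<open>Uniqueness, applied to the solution through \<open>(r, v)\<close> restarted at
  \<open>s\<close>. The times are in no particular order, so \<open>T t s\<close> is invertible with
  inverse \<open>T s t\<close>.\<close>

lemma T_apply_T:
  "t \<ge> 0 \<Longrightarrow> s \<ge> 0 \<Longrightarrow> r \<ge> 0 \<Longrightarrow> blinfun_apply (T t s) (blinfun_apply (T s r) v) = blinfun_apply (T t r) v"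
  using solution_eq_T[OF T_solution[of r v], of s t] by (simp only:)

lemma T_compose: "t \<ge> 0 \<Longrightarrow> s \<ge> 0 \<Longrightarrow> r \<ge> 0 \<Longrightarrow> T t s o\<^sub>L T s r = T t r"
  by (intro blinfun_eqI) (simp add: T_apply_T)

lemma A_bounded: "\<exists>a\<ge>0. \<forall>t\<in>{0..N}. norm (A t) \<le> a"
proof -
  have "bounded (A ` {0..N})"
    by (intro compact_imp_bounded compact_continuous_image continuous_on_subset[OF A_cont]) auto
  then obtain a where "\<forall>t\<in>{0..N}. norm (A t) \<le> a"
    by (auto simp: bounded_iff)
  then show ?thesis
    by (intro exI[of _ "max a 0"]) auto
qed

text \<open>Increments of a solution are at most \<open>a * (t - s)\<close> times its maximum, and
  the Gronwall constant is the same for every solution, hence for every \<open>v\<close> and every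
  starting time.\<close>

lemma T_bounded: "\<exists>C>0. \<forall>t\<in>{0..N}. \<forall>s\<in>{0..N}. norm (T t s) \<le> C"
proof -
  obtain a where a: "a \<ge> 0" "\<And>t. t \<in> {0..N} \<Longrightarrow> norm (A t) \<le> a"
    using A_bounded[of N] by blast
  have "continuous_on {0..N} (\<lambda>t. a * t)"
    by (intro continuous_intros)
  from gronwall_two_sided[OF this, where ?'a='a] obtain C where C: "C > 0"
    "\<And>x::real \<Rightarrow> 'a. continuous_on {0..N} x \<Longrightarrow>
      (\<forall>s t B. 0 \<le> s \<longrightarrow> s \<le> t \<longrightarrow> t \<le> N \<longrightarrow> (\<forall>r\<in>{s..t}. norm (x r) \<le> B)
        \<longrightarrow> norm (x t - x s) \<le> (a * t - a * s) * B) \<Longrightarrow>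
      (\<forall>s\<in>{0..N}. \<forall>t\<in>{0..N}. norm (x t) \<le> C * norm (x s))"
    by blast
  have "norm (T t s) \<le> C" if t: "t \<in> {0..N}" and s: "s \<in> {0..N}" for t s
  proof (rule norm_blinfun_bound)
    fix v
    let ?x = "\<lambda>t. blinfun_apply (T t s) v"
    have sol: "classical_solution (\<lambda>t x. blinfun_apply (A t) x) ?x"
      using s by (intro T_solution) auto
    have "\<forall>s\<in>{0..N}. \<forall>t\<in>{0..N}. norm (?x t) \<le> C * norm (?x s)"
    proof (rule C(2))
      show "continuous_on {0..N} ?x"
        by (rule continuous_on_subset[OF classical_solution_continuous[OF sol]]) auto
      show "\<forall>s t B. 0 \<le> s \<longrightarrow> s \<le> t \<longrightarrow> t \<le> N \<longrightarrow> (\<forall>r\<in>{s..t}. norm (?x r) \<le> B)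
        \<longrightarrow> norm (?x t - ?x s) \<le> (a * t - a * s) * B"
      proof (intro allI impI)
        fix p q B assume pq: "0 \<le> p" "p \<le> q" "q \<le> N" and B: "\<forall>r\<in>{p..q}. norm (?x r) \<le> B"
        have B0: "B \<ge> 0"
          using B pq(2) by (meson atLeastAtMost_iff norm_ge_zero order_refl order_trans)
        have "norm (?x q - ?x p) \<le> a * B * measure lborel (cbox p q)"
        proof (rule has_integral_bound)
          show "((\<lambda>r. blinfun_apply (A r) (?x r)) has_integral (?x q - ?x p)) (cbox p q)"
            using classical_solution_has_integral[OF sol pq(1,2)] by simp
          show "norm (blinfun_apply (A r) (?x r)) \<le> a * B" if "r \<in> cbox p q" for r
          proof -
            have "norm (blinfun_apply (A r) (?x r)) \<le> norm (A r) * norm (?x r)"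
              by (rule norm_blinfun)
            also have "\<dots> \<le> a * B"
              using that a B pq by (intro mult_mono) auto
            finally show ?thesis .
          qed
        qed (use a B0 in simp)
        then show "norm (?x q - ?x p) \<le> (a * q - a * p) * B"
          using pq by (simp add: algebra_simps)
      qed
    qed
    then show "norm (blinfun_apply (T t s) v) \<le> C * norm v"
      using t s T_refl[of s] by force
  qed (use C in simp)
  then show ?thesis
    using C(1) by blast
qed

lemma T_increment:
  assumes "0 \<le> s" "s \<le> t" "0 \<le> r"
  shows "((\<lambda>q. blinfun_apply (A q) (blinfun_apply (T q r) v)) has_integral
    (blinfun_apply (T t r) v - blinfun_apply (T s r) v)) {s..t}"
  by (rule classical_solution_has_integral[OF T_solution]) (use assms in auto)

lemma T_lipschitz:
  "\<exists>C\<ge>0. \<forall>t\<in>{0..N}. \<forall>s\<in>{0..N}. \<forall>r\<in>{0..N}. norm (T t r - T s r) \<le> C * \<bar>t - s\<bar>"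
proof -
  obtain a where a: "a \<ge> 0" "\<And>t. t \<in> {0..N} \<Longrightarrow> norm (A t) \<le> a"
    using A_bounded[of N] by blast
  obtain C where C: "C > 0" "\<And>t s. t \<in> {0..N} \<Longrightarrow> s \<in> {0..N} \<Longrightarrow> norm (T t s) \<le> C"
    using T_bounded[of N] by blast
  have le: "norm (T t r - T s r) \<le> a * C * (t - s)"
    if "0 \<le> s" "s \<le> t" "t \<le> N" "r \<in> {0..N}" for t s r
  proof (rule norm_blinfun_bound)
    fix v
    have "norm (blinfun_apply (T t r) v - blinfun_apply (T s r) v) \<le> a * C * norm v * measure lborel (cbox s t)"
    proof (rule has_integral_bound)
      show "((\<lambda>q. blinfun_apply (A q) (blinfun_apply (T q r) v)) has_integral
          (blinfun_apply (T t r) v - blinfun_apply (T s r) v)) (cbox s t)"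
        using T_increment[of s t r v] that by auto
      show "norm (blinfun_apply (A q) (blinfun_apply (T q r) v)) \<le> a * C * norm v" if q: "q \<in> cbox s t" for q
      proof -
        have "norm (blinfun_apply (A q) (blinfun_apply (T q r) v)) \<le> norm (A q) * (norm (T q r) * norm v)"
          by (meson mult_left_mono norm_blinfun norm_ge_zero order_trans)
        also have "\<dots> \<le> a * (C * norm v)"
          using q that \<open>0 \<le> s\<close> \<open>t \<le> N\<close> \<open>r \<in> {0..N}\<close> a C by (intro mult_mono) auto
        finally show ?thesis by simp
      qed
    qed (use a C in simp)
    then show "norm (blinfun_apply (T t r - T s r) v) \<le> a * C * (t - s) * norm v"
      using that by (simp add: blinfun.diff_left mult_ac)
  qed (use that a C in auto)
  show ?thesis
  proof (intro exI[of _ "a * C"] conjI ballI)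
    fix t s r assume *: "t \<in> {0..N}" "s \<in> {0..N}" "r \<in> {0..N}"
    show "norm (T t r - T s r) \<le> a * C * \<bar>t - s\<bar>"
      using le[of s t r] le[of t s r] * by (cases "s \<le> t") (auto simp: norm_minus_commute)
  qed (use a C in simp)
qed

lemma T_continuous_fst: "continuous_on {0..} (\<lambda>t. T t 0)"
proof (rule continuous_on_atLeast_if_Icc)
  fix N :: real assume "0 \<le> N"
  obtain C where C: "C \<ge> 0" "\<forall>t\<in>{0..N}. \<forall>s\<in>{0..N}. \<forall>r\<in>{0..N}. norm (T t r - T s r) \<le> C * \<bar>t - s\<bar>"
    using T_lipschitz[of N] by blast
  then have "C-lipschitz_on {0..N} (\<lambda>t. T t 0)"
    using \<open>0 \<le> N\<close> by (auto simp: lipschitz_on_def dist_norm)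
  then show "continuous_on {0..N} (\<lambda>t. T t 0)"
    by (rule lipschitz_on_continuous_on)
qed

lemma T_continuous_snd: "continuous_on {0..} (\<lambda>s. T 0 s)"
proof (rule continuous_on_atLeast_if_Icc)
  fix N :: real assume N: "0 \<le> N"
  obtain C where C: "C \<ge> 0" "\<forall>t\<in>{0..N}. \<forall>s\<in>{0..N}. \<forall>r\<in>{0..N}. norm (T t r - T s r) \<le> C * \<bar>t - s\<bar>"
    using T_lipschitz[of N] by blast
  obtain D where D: "D > 0" "\<And>t s. t \<in> {0..N} \<Longrightarrow> s \<in> {0..N} \<Longrightarrow> norm (T t s) \<le> D"
    using T_bounded[of N] by blast
  have "(D * C * D)-lipschitz_on {0..N} (\<lambda>s. T 0 s)"
    unfolding lipschitz_on_def
  proof (intro conjI ballI)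
    fix s q assume sq: "s \<in> {0..N}" "q \<in> {0..N}"
    \<comment> \<open>Resolvent-type identity for inverses: it turns Lipschitz dependence on the
      first time into Lipschitz dependence on the second.\<close>
    have "T 0 s - T 0 q = T 0 s o\<^sub>L (T q 0 - T s 0) o\<^sub>L T 0 q"
      using sq by (intro blinfun_eqI) (simp add: blinfun.diff_left blinfun.diff_right T_apply_T T_refl)
    also have "norm \<dots> \<le> norm (T 0 s) * norm (T q 0 - T s 0) * norm (T 0 q)"
      by (meson mult_right_mono norm_blinfun_compose norm_ge_zero order_trans)
    also have "\<dots> \<le> D * (C * \<bar>q - s\<bar>) * D"
      using sq N C D by (intro mult_mono) auto
    finally show "dist (T 0 s) (T 0 q) \<le> D * C * D * dist s q"
      by (simp add: dist_norm mult_ac abs_minus_commute)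
  qed (use C D in auto)
  then show "continuous_on {0..N} (\<lambda>s. T 0 s)"
    by (rule lipschitz_on_continuous_on)
qed

lemma T_continuous: "continuous_on ({0..} \<times> {0..}) (\<lambda>(t, s). T t s)"
proof -
  have "continuous_on ({0..} \<times> {0..}) (\<lambda>z. T (fst z) 0 o\<^sub>L T 0 (snd z))"
    by (intro bounded_bilinear.continuous_on[OF bounded_bilinear_blinfun_compose]
        continuous_on_compose2[OF T_continuous_fst] continuous_on_compose2[OF T_continuous_snd]
        continuous_intros) auto
  then show ?thesis
    by (rule continuous_on_cong[THEN iffD1, rotated 2]) (auto simp: T_compose)
qed

text \<open>The defect \<open>u(t) = w(t) - \<integral>\<^sub>0\<^sup>t (A w + g)\<close> has increments bounded by
  \<open>K (t - s) \<integral>\<^sub>s\<^sup>t h\<close>, so its derivative is zero even where \<open>w\<close> is not differentiable.\<close>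

lemma duhamel:
  assumes g: "strongly_measurable (lebesgue_on {0..}) g"
    and h: "\<And>N. 0 \<le> N \<Longrightarrow> h integrable_on {0..N}" "\<And>t. 0 \<le> t \<Longrightarrow> norm (g t) \<le> h t"
    and w: "\<And>t. 0 \<le> t \<Longrightarrow> w t = blinfun_apply (T t 0) (w0 + integral {0..t} (\<lambda>s. blinfun_apply (T 0 s) (g s)))"
  shows "continuous_on {0..} w"
    and "\<And>s t. 0 \<le> s \<Longrightarrow> s \<le> t \<Longrightarrow> ((\<lambda>r. blinfun_apply (A r) (w r) + g r) has_integral (w t - w s)) {s..t}"
proof -
  define G where "G r = blinfun_apply (T 0 r) (g r)" for r
  \<comment> \<open>Variation of constants: \<open>Y\<close> is the solution transported back to
    time 0, so that only the integrated forcing moves it.\<close>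
  define Y where "Y t = w0 + integral {0..t} G" for t
  have wY: "w t = blinfun_apply (T t 0) (Y t)" if "0 \<le> t" for t
    using w[OF that] by (simp add: Y_def G_def[abs_def])
  have G_meas: "strongly_measurable (lebesgue_on {0..}) G"
    unfolding G_def
    by (intro strongly_measurable_blinfun_apply g strongly_measurable_continuous_on_atLeast T_continuous_snd)
  have h0: "0 \<le> h t" if "0 \<le> t" for t
    using h(2)[OF that] by (rule order_trans[OF norm_ge_zero])
  have h_sub: "h integrable_on {s..t}" if "0 \<le> s" for s t
    by (cases "0 \<le> t") (use that in \<open>auto intro!: integrable_on_subinterval[OF h(1)[of t]]\<close>)
  have g_int: "g integrable_on {s..t}" if "0 \<le> s" for s t
    by (rule strongly_measurable_integrable_interval[OF strongly_measurable_lebesgue_on_subset[OF g] h_sub])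
      (use that h in auto)
  have G_bound: "norm (G r) \<le> C * h r"
    if "r \<in> {0..N}" and C: "\<And>t s. t \<in> {0..N} \<Longrightarrow> s \<in> {0..N} \<Longrightarrow> norm (T t s) \<le> C" for r N C
  proof -
    have "norm (G r) \<le> norm (T 0 r) * norm (g r)"
      unfolding G_def by (rule norm_blinfun)
    also have "\<dots> \<le> C * h r"
      using that by (intro mult_mono C h order_trans[OF norm_ge_zero C[of 0 r]]) auto
    finally show ?thesis .
  qed
  have G_int: "G integrable_on {s..t}" if "0 \<le> s" for s t
  proof -
    obtain C where C: "C > 0" "\<And>p q. p \<in> {0..t} \<Longrightarrow> q \<in> {0..t} \<Longrightarrow> norm (T p q) \<le> C"
      using T_bounded[of t] by blast
    have Ch: "(\<lambda>r. C * h r) integrable_on {s..t}"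
      using h_sub[OF that] by (rule integrable_on_mult_right)
    show ?thesis
      by (rule strongly_measurable_integrable_interval[OF strongly_measurable_lebesgue_on_subset[OF G_meas] Ch])
        (use that G_bound[OF _ C(2)] in auto)
  qed
  have Y_diff: "Y t - Y s = integral {s..t} G" if "0 \<le> s" "s \<le> t" for s t
    using Henstock_Kurzweil_Integration.integral_combine[OF that G_int] by (simp add: Y_def algebra_simps)
  have Y_cont: "continuous_on {0..} Y"
    unfolding Y_def
    by (intro continuous_on_atLeast_if_Icc continuous_on_add continuous_on_const
        indefinite_integral_continuous_1 G_int) simp
  show w_cont: "continuous_on {0..} w"
  proof (rule continuous_on_cong[THEN iffD1, OF refl])
    show "continuous_on {0..} (\<lambda>t. blinfun_apply (T t 0) (Y t))"
      by (intro blinfun.continuous_on T_continuous_fst Y_cont)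
  qed (simp add: wY)
  have Aw_int: "(\<lambda>r. blinfun_apply (A r) (w r)) integrable_on {s..t}" if "0 \<le> s" for s t
    using that
    by (intro integrable_continuous_interval blinfun.continuous_on continuous_on_subset[OF A_cont]
        continuous_on_subset[OF w_cont]) auto
  define u where "u t = w t - integral {0..t} (\<lambda>r. blinfun_apply (A r) (w r) + g r)" for t
  have f_int: "(\<lambda>r. blinfun_apply (A r) (w r) + g r) integrable_on {s..t}" if "0 \<le> s" for s t
    using that by (intro integrable_add Aw_int g_int)
  have u_const: "u N = u 0" if N: "0 \<le> N" for N
  proof -
    obtain a where a: "a \<ge> 0" "\<And>t. t \<in> {0..N} \<Longrightarrow> norm (A t) \<le> a"
      using A_bounded[of N] by blast
    obtain C where C: "C > 0" "\<And>t s. t \<in> {0..N} \<Longrightarrow> s \<in> {0..N} \<Longrightarrow> norm (T t s) \<le> C"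
      using T_bounded[of N] by blast
    obtain D where D: "D \<ge> 0" "\<And>t s r. t \<in> {0..N} \<Longrightarrow> s \<in> {0..N} \<Longrightarrow> r \<in> {0..N} \<Longrightarrow> norm (T t r - T s r) \<le> D * \<bar>t - s\<bar>"
      using T_lipschitz[of N] by blast
    define M where "M t = integral {0..t} h" for t
    show ?thesis
    \<comment> \<open>\<open>D * C\<close> comes from moving the forcing from \<open>r\<close> to
      \<open>t\<close>, and \<open>a * C * C\<close> from freezing \<open>Y\<close> at
      \<open>s\<close> under \<open>A\<close>.\<close>
    proof (rule constant_if_superlinear_increments[where M=M and K="D * C + a * C * C"])
      show "continuous_on {0..N} M"
        unfolding M_def by (rule indefinite_integral_continuous_1[OF h(1)[OF N]])
      fix s t assume st: "0 \<le> s" "s \<le> t" "t \<le> N"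
      have M_diff: "M q - M p = integral {p..q} h" if "0 \<le> p" "p \<le> q" for p q
        using Henstock_Kurzweil_Integration.integral_combine[OF that h_sub] by (simp add: M_def algebra_simps)
      \<comment> \<open>The first difference compares the forcing transported to the end time
        \<open>t\<close> with the forcing itself; the second compares \<open>A\<close> along the
        homogeneous solution started from \<open>Y s\<close> with \<open>A\<close> along
        \<open>w\<close>. Each is small when \<open>t - s\<close> is, and together they integrate to
        the defect.\<close>
      let ?F = "\<lambda>r. (blinfun_apply (T t 0) (G r) - g r)
        + (blinfun_apply (A r) (blinfun_apply (T r 0) (Y s)) - blinfun_apply (A r) (w r))"
      have "((\<lambda>r. blinfun_apply (T t 0) (G r)) has_integral blinfun_apply (T t 0) (Y t - Y s)) {s..t}"
        using has_integral_linear[OF integrable_integral[OF G_int[OF st(1)]] blinfun.bounded_linear_right, of "T t 0" t]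
          Y_diff[OF st(1,2)] by (simp add: o_def)
      moreover have "((\<lambda>r. blinfun_apply (A r) (blinfun_apply (T r 0) (Y s))) has_integral
          (blinfun_apply (T t 0) (Y s) - blinfun_apply (T s 0) (Y s))) {s..t}"
        using st by (intro T_increment) auto
      ultimately have "(?F has_integral ((blinfun_apply (T t 0) (Y t - Y s) - integral {s..t} g)
          + ((blinfun_apply (T t 0) (Y s) - blinfun_apply (T s 0) (Y s))
              - integral {s..t} (\<lambda>r. blinfun_apply (A r) (w r))))) {s..t}"
        by (intro has_integral_add has_integral_diff integrable_integral g_int Aw_int st(1))
      moreover have "u t - u s = (blinfun_apply (T t 0) (Y t - Y s) - integral {s..t} g)
          + ((blinfun_apply (T t 0) (Y s) - blinfun_apply (T s 0) (Y s))
              - integral {s..t} (\<lambda>r. blinfun_apply (A r) (w r)))"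
      proof -
        have "u t - u s = w t - w s - integral {s..t} (\<lambda>r. blinfun_apply (A r) (w r) + g r)"
          using Henstock_Kurzweil_Integration.integral_combine[OF st(1,2) f_int]
          by (simp add: u_def algebra_simps)
        also have "integral {s..t} (\<lambda>r. blinfun_apply (A r) (w r) + g r)
            = integral {s..t} (\<lambda>r. blinfun_apply (A r) (w r)) + integral {s..t} g"
          using st by (intro integral_add Aw_int g_int)
        finally show ?thesis
          using st by (simp add: wY blinfun.diff_right)
      qed
      ultimately have F: "(?F has_integral (u t - u s)) {s..t}" by simp
      have F_bound: "norm (?F r) \<le> (D * C * (t - s)) * h r + a * C * C * (M t - M s)" if r: "r \<in> {s..t}" for r
      proof -
        \<comment> \<open>Writing \<open>g r\<close> as \<open>T r 0\<close> applied to
          \<open>G r\<close> exposes the factor \<open>T t 0 - T r 0\<close>, which supplies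
          \<open>t - s\<close>; the merely integrable \<open>h\<close> supplies
          \<open>M t - M s\<close> after integration.\<close>
        have "blinfun_apply (T t 0) (G r) - g r = blinfun_apply (T t 0 - T r 0) (G r)"
          using st r by (simp add: G_def blinfun.diff_left T_apply_T T_refl)
        also have "norm \<dots> \<le> norm (T t 0 - T r 0) * norm (G r)"
          by (rule norm_blinfun)
        also have "\<dots> \<le> (D * (t - s)) * (C * h r)"
        proof (rule mult_mono)
          have "norm (T t 0 - T r 0) \<le> D * \<bar>t - r\<bar>"
            using st r by (intro D) auto
          also have "\<dots> \<le> D * (t - s)"
            using D(1) r by (intro mult_left_mono) auto
          finally show "norm (T t 0 - T r 0) \<le> D * (t - s)" .
          show "norm (G r) \<le> C * h r"
            using st r by (intro G_bound[where N=N] C) auto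
        qed (use D st in auto)
        finally have 1: "norm (blinfun_apply (T t 0) (G r) - g r) \<le> D * C * (t - s) * h r"
          by (simp add: mult_ac)
        have Ydiff: "norm (Y s - Y r) \<le> C * (M t - M s)"
        proof -
          have "norm (Y r - Y s) \<le> integral {s..r} (\<lambda>q. C * h q)"
          proof -
            have "norm (integral {s..r} G) \<le> integral {s..r} (\<lambda>q. C * h q)"
              by (intro integral_norm_bound_integral G_int integrable_on_mult_right h_sub G_bound[where N=N] C)
                (use st r in auto)
            then show ?thesis using st r by (simp add: Y_diff)
          qed
          also have "\<dots> = C * (M r - M s)"
            using st r by (simp add: M_diff)
          also have "\<dots> \<le> C * (M t - M s)"
          proof -
            have "0 \<le> integral {r..t} h"
              using st r by (intro integral_nonneg h_sub h0) auto
            then have "M r \<le> M t" using M_diff[of r t] st r by simp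
            then show ?thesis using C by (intro mult_left_mono) auto
          qed
          finally show ?thesis by (simp add: norm_minus_commute)
        qed
        have "blinfun_apply (A r) (blinfun_apply (T r 0) (Y s)) - blinfun_apply (A r) (w r)
            = blinfun_apply (A r) (blinfun_apply (T r 0) (Y s - Y r))"
          using st r by (simp add: wY blinfun.diff_right)
        also have "norm \<dots> \<le> norm (A r) * (norm (T r 0) * norm (Y s - Y r))"
          by (meson mult_left_mono norm_blinfun norm_ge_zero order_trans)
        also have "\<dots> \<le> a * (C * (C * (M t - M s)))"
          using st r a C Ydiff by (intro mult_mono) auto
        finally have 2: "norm (blinfun_apply (A r) (blinfun_apply (T r 0) (Y s)) - blinfun_apply (A r) (w r))
            \<le> a * C * C * (M t - M s)" by (simp add: mult_ac)
        show ?thesis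
          using norm_triangle_ineq order_trans add_mono[OF 1 2] by blast
      qed
      have "norm (u t - u s) \<le> integral {s..t} (\<lambda>r. (D * C * (t - s)) * h r + a * C * C * (M t - M s))"
        unfolding integral_unique[OF F, symmetric]
        by (rule integral_norm_bound_integral[OF has_integral_integrable[OF F]])
          (use st F_bound in \<open>auto intro!: integrable_add integrable_on_mult_right h_sub\<close>)
      also have "\<dots> = D * C * (t - s) * (M t - M s) + a * C * C * (M t - M s) * (t - s)"
        using st by (subst integral_add) (auto intro!: integrable_on_mult_right h_sub simp: M_diff)
      finally show "norm (u t - u s) \<le> (D * C + a * C * C) * (t - s) * (M t - M s)"
        by (simp add: algebra_simps)
    qed (rule N)
  qed
  show "((\<lambda>r. blinfun_apply (A r) (w r) + g r) has_integral (w t - w s)) {s..t}"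
    if st: "0 \<le> s" "s \<le> t" for s t
  proof -
    have "u t = u s" using u_const[of t] u_const[of s] st by simp
    moreover have "integral {0..t} (\<lambda>r. blinfun_apply (A r) (w r) + g r)
        - integral {0..s} (\<lambda>r. blinfun_apply (A r) (w r) + g r)
        = integral {s..t} (\<lambda>r. blinfun_apply (A r) (w r) + g r)"
      unfolding Henstock_Kurzweil_Integration.integral_combine[OF st f_int[OF order_refl], symmetric] by simp
    ultimately have "w t - w s = integral {s..t} (\<lambda>r. blinfun_apply (A r) (w r) + g r)"
      unfolding u_def by (metis (no_types, lifting) add_diff_cancel_left' diff_add_cancel diff_diff_eq2)
    then show ?thesis
      using integrable_integral[OF f_int[OF st(1)]] by simp
  qed
qed

end

section \<open>The Green operator of a trichotomy\<close>

lemma integrable_on_if_nn_integral_le: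
  fixes \<phi> :: "'b::euclidean_space \<Rightarrow> real"
  assumes meas: "\<phi> \<in> borel_measurable (lebesgue_on S)" and S: "S \<in> sets lebesgue"
    and nonneg: "\<And>s. s \<in> S \<Longrightarrow> 0 \<le> \<phi> s" and c: "0 \<le> c"
    and le: "(\<integral>\<^sup>+s\<in>S. ennreal (\<phi> s) \<partial>lebesgue) \<le> ennreal c"
  shows "\<phi> integrable_on S" and "integral S \<phi> \<le> c"
proof -
  let ?M = "lebesgue_on S"
  have le': "(\<integral>\<^sup>+s. ennreal (\<phi> s) \<partial>?M) \<le> ennreal c"
    using le S by (simp add: nn_integral_restrict_space)
  have "(\<integral>\<^sup>+s. ennreal (norm (\<phi> s)) \<partial>?M) = (\<integral>\<^sup>+s. ennreal (\<phi> s) \<partial>?M)"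
    by (rule nn_integral_cong) (simp add: nonneg)
  also have "\<dots> < \<infinity>"
    using le' by (simp add: le_less_trans)
  finally have int: "integrable ?M \<phi>"
    using meas by (intro integrableI_bounded)
  then show "\<phi> integrable_on S"
    using S by (rule integrable_on_lebesgue_on)
  have "ennreal (integral S \<phi>) = ennreal (integral\<^sup>L ?M \<phi>)"
    using int S by (simp add: lebesgue_integral_eq_integral)
  also have "\<dots> = (\<integral>\<^sup>+s. ennreal (\<phi> s) \<partial>?M)"
    by (rule nn_integral_eq_integral[symmetric]) (use int nonneg in \<open>auto intro!: AE_I2\<close>)
  also have "\<dots> \<le> ennreal c" by (rule le')
  finally show "integral S \<phi> \<le> c"
    using c by simp
qed

lemma borel_measurable_lebesgue_on_if_borel:
  fixes \<psi> :: "'b::euclidean_space \<Rightarrow> real"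
  assumes "\<psi> \<in> borel_measurable (restrict_space borel S)" and "S \<in> sets borel"
  shows "\<psi> \<in> borel_measurable (lebesgue_on S)"
proof -
  have "(\<lambda>x. indicator S x *\<^sub>R \<psi> x) \<in> borel_measurable borel"
    using assms by (simp add: borel_measurable_restrict_space_iff)
  then have "(\<lambda>x. indicator S x *\<^sub>R \<psi> x) \<in> borel_measurable lebesgue"
    by (simp add: measurable_completion)
  then show ?thesis
    using assms by (simp add: borel_measurable_restrict_space_iff)
qed

locale trichotomy_perturbation = linear_evolution A T
  for A :: "real \<Rightarrow> 'a::banach \<Rightarrow>\<^sub>L 'a" and T :: "real \<Rightarrow> real \<Rightarrow> 'a \<Rightarrow>\<^sub>L 'a" +
  fixes f :: "real \<Rightarrow> 'a \<Rightarrow> 'a"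
    and Ks Ku :: "'k set"
    and P :: "'k \<Rightarrow> real \<Rightarrow> 'a \<Rightarrow>\<^sub>L 'a"
    and \<mu> \<nu> :: "'k \<Rightarrow> real \<Rightarrow> real"
    and lam :: "'k \<Rightarrow> real"
  assumes f_cont: "continuous_on ({0..} \<times> UNIV) (\<lambda>(t, x). f t x)"
    and K_fin: "finite (Ks \<union> Ku)"
    and K_disj: "Ks \<inter> Ku = {}"
    and P_proj: "\<And>k t. k \<in> Ks \<union> Ku \<Longrightarrow> 0 \<le> t \<Longrightarrow> P k t o\<^sub>L P k t = P k t"
    and P_meas: "\<And>k. k \<in> Ks \<union> Ku \<Longrightarrow> strongly_measurable (lebesgue_on {0..}) (P k)"
    and \<mu>_meas: "\<And>k. k \<in> Ks \<union> Ku \<Longrightarrow> \<mu> k \<in> borel_measurable (restrict_space borel {0..})"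
    and \<nu>_meas: "\<And>k. k \<in> Ks \<union> Ku \<Longrightarrow> \<nu> k \<in> borel_measurable (restrict_space borel {0..})"
    and \<mu>_nonneg: "\<And>k t. k \<in> Ks \<union> Ku \<Longrightarrow> 0 \<le> t \<Longrightarrow> 0 \<le> \<mu> k t"
    and \<nu>_nonneg: "\<And>k t. k \<in> Ks \<union> Ku \<Longrightarrow> 0 \<le> t \<Longrightarrow> 0 \<le> \<nu> k t"
    and lam_pos: "\<And>k. k \<in> Ks \<union> Ku \<Longrightarrow> 0 < lam k"
    and stable_\<nu>: "\<And>k. k \<in> Ks \<Longrightarrow>
      (SUP t\<in>{0..}. \<integral>\<^sup>+s\<in>{0..t}. ennreal (norm (T t s o\<^sub>L P k s) * \<nu> k s) \<partial>lebesgue) < \<infinity>"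
    and stable_\<mu>: "\<And>k. k \<in> Ks \<Longrightarrow>
      (SUP t\<in>{0..}. \<integral>\<^sup>+s\<in>{0..t}. ennreal (norm (T t s o\<^sub>L P k s) * \<mu> k s) \<partial>lebesgue)
        \<le> ennreal (lam k)"
    and unstable_\<nu>: "\<And>k. k \<in> Ku \<Longrightarrow>
      (SUP t\<in>{0..}. \<integral>\<^sup>+s\<in>{t..}. ennreal (norm (T t s o\<^sub>L P k s) * \<nu> k s) \<partial>lebesgue) < \<infinity>"
    and unstable_\<mu>: "\<And>k. k \<in> Ku \<Longrightarrow>
      (SUP t\<in>{0..}. \<integral>\<^sup>+s\<in>{t..}. ennreal (norm (T t s o\<^sub>L P k s) * \<mu> k s) \<partial>lebesgue)
        \<le> ennreal (lam k)"
    and f_bound: "\<And>k t. k \<in> Ks \<union> Ku \<Longrightarrow> 0 \<le> t \<Longrightarrow>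
      sup_norm (\<lambda>x. blinfun_apply (P k t) (f t x)) \<le> ennreal (\<nu> k t)"
    and f_lip: "\<And>k t x y. k \<in> Ks \<union> Ku \<Longrightarrow> 0 \<le> t \<Longrightarrow>
      norm (blinfun_apply (P k t) (f t x) - blinfun_apply (P k t) (f t y)) \<le> \<mu> k t * norm (x - y)"
    and lam_sum: "(\<Sum>k\<in>Ks \<union> Ku. lam k) < 1"
begin

text \<open>The stable and unstable integrals of \<open>G\<close> only differ in the domain of integration and in
  the sign, so they are treated together.\<close>

definition window :: "'k \<Rightarrow> real \<Rightarrow> real set" where
  "window k t = (if k \<in> Ks then {0..t} else {t..})"

definition knorm :: "'k \<Rightarrow> real \<Rightarrow> real \<Rightarrow> real" where
  "knorm k t s = norm (T t s o\<^sub>L P k s)"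

definition force :: "'k \<Rightarrow> (real \<Rightarrow> 'a) \<Rightarrow> real \<Rightarrow> 'a" where
  "force k c s = blinfun_apply (P k s) (f s (c s))"

text \<open>A Green operator of Perron type: the stable part accumulates from time 0 and the
  unstable part is integrated back from infinity, where its kernel bound lives. Moving the lower
  limit in \<open>- \<integral>\<close> from \<open>t\<close> to infinity also contributes plus the
  integrand, so both parts carry the forcing with the same sign.\<close>

definition green :: "(real \<Rightarrow> 'a) \<Rightarrow> real \<Rightarrow> 'a" where
  "green c t = (\<Sum>k\<in>Ks \<union> Ku. (if k \<in> Ks then 1 else - 1) *\<^sub>R
     integral (window k t) (\<lambda>s. blinfun_apply (T t s) (force k c s)))"

section \<open>Kernel estimates and integrability of the Green integrands\<close>

lemma window_subset: "0 \<le> t \<Longrightarrow> window k t \<subseteq> {0..}"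
  by (auto simp: window_def)

lemma window_lebesgue: "window k t \<in> sets lebesgue"
  by (simp add: window_def)

lemma knorm_nonneg: "0 \<le> knorm k t s"
  by (simp add: knorm_def)

lemma strongly_measurable_T:
  assumes "0 \<le> t"
  shows "strongly_measurable (lebesgue_on {0..}) (T t)"
proof -
  have "continuous_on {0..} (\<lambda>s. case (t, s) of (t, s) \<Rightarrow> T t s)"
    by (rule continuous_on_compose2[OF T_continuous]) (use assms in \<open>auto intro!: continuous_intros\<close>)
  then show ?thesis
    by (simp add: strongly_measurable_continuous_on_atLeast)
qed

lemma knorm_measurable:
  assumes "k \<in> Ks \<union> Ku" "0 \<le> t"
  shows "knorm k t \<in> borel_measurable (lebesgue_on {0..})"
  unfolding knorm_def
  by (intro borel_measurable_strongly_measurable strongly_measurable_norm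
      strongly_measurable_blinfun_compose strongly_measurable_T P_meas assms) simp

lemma knorm_integrable:
  assumes k: "k \<in> Ks \<union> Ku" and t: "0 \<le> t"
    and \<psi>: "\<psi> \<in> borel_measurable (restrict_space borel {0..})" "\<And>s. 0 \<le> s \<Longrightarrow> 0 \<le> \<psi> s"
    and c: "0 \<le> c" and le: "(SUP t\<in>{0..}. \<integral>\<^sup>+s\<in>window k t. ennreal (knorm k t s * \<psi> s) \<partial>lebesgue) \<le> ennreal c"
  shows "(\<lambda>s. knorm k t s * \<psi> s) integrable_on window k t"
    and "integral (window k t) (\<lambda>s. knorm k t s * \<psi> s) \<le> c"
proof -
  have "\<psi> \<in> borel_measurable (lebesgue_on {0..})"
    using \<psi>(1) by (rule borel_measurable_lebesgue_on_if_borel) simp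
  then have "(\<lambda>s. knorm k t s * \<psi> s) \<in> borel_measurable (lebesgue_on {0..})"
    using knorm_measurable[OF k t] by (intro borel_measurable_times)
  then have meas: "(\<lambda>s. knorm k t s * \<psi> s) \<in> borel_measurable (lebesgue_on (window k t))"
    by (rule measurable_restrict_mono[OF _ window_subset[OF t]])
  have nonneg: "0 \<le> knorm k t s * \<psi> s" if "s \<in> window k t" for s
    using that window_subset[OF t, of k] \<psi>(2)[of s] knorm_nonneg by (intro mult_nonneg_nonneg) auto
  have le': "(\<integral>\<^sup>+s\<in>window k t. ennreal (knorm k t s * \<psi> s) \<partial>lebesgue) \<le> ennreal c"
    using t by (intro order_trans[OF SUP_upper le]) auto
  show "(\<lambda>s. knorm k t s * \<psi> s) integrable_on window k t"
    "integral (window k t) (\<lambda>s. knorm k t s * \<psi> s) \<le> c"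
    using integrable_on_if_nn_integral_le[OF meas window_lebesgue nonneg c le'] by blast+
qed

lemma knorm_\<mu>:
  assumes k: "k \<in> Ks \<union> Ku" and t: "0 \<le> t"
  shows "(\<lambda>s. knorm k t s * \<mu> k s) integrable_on window k t"
    and "integral (window k t) (\<lambda>s. knorm k t s * \<mu> k s) \<le> lam k"
proof -
  have "(SUP t\<in>{0..}. \<integral>\<^sup>+s\<in>window k t. ennreal (knorm k t s * \<mu> k s) \<partial>lebesgue) \<le> ennreal (lam k)"
    using stable_\<mu>[of k] unstable_\<mu>[of k] k by (cases "k \<in> Ks") (auto simp: window_def knorm_def)
  from knorm_integrable[OF k t \<mu>_meas \<mu>_nonneg _ this] lam_pos[OF k]
  show "(\<lambda>s. knorm k t s * \<mu> k s) integrable_on window k t"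
    "integral (window k t) (\<lambda>s. knorm k t s * \<mu> k s) \<le> lam k"
    using k by auto
qed

lemma knorm_\<nu>:
  assumes k: "k \<in> Ks \<union> Ku"
  shows "\<exists>D\<ge>0. \<forall>t\<ge>0. (\<lambda>s. knorm k t s * \<nu> k s) integrable_on window k t
    \<and> integral (window k t) (\<lambda>s. knorm k t s * \<nu> k s) \<le> D"
proof -
  let ?S = "SUP t\<in>{0..}. \<integral>\<^sup>+s\<in>window k t. ennreal (knorm k t s * \<nu> k s) \<partial>lebesgue"
  have "?S < \<infinity>"
    using stable_\<nu>[of k] unstable_\<nu>[of k] k by (cases "k \<in> Ks") (auto simp: window_def knorm_def)
  then have le: "?S \<le> ennreal (enn2real ?S)"
    by simp
  show ?thesis
  proof (intro exI[of _ "enn2real ?S"] conjI allI impI)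
    fix t :: real assume "0 \<le> t"
    from knorm_integrable[OF k this \<nu>_meas[OF k] \<nu>_nonneg[OF k] _ le]
    show "(\<lambda>s. knorm k t s * \<nu> k s) integrable_on window k t"
      "integral (window k t) (\<lambda>s. knorm k t s * \<nu> k s) \<le> enn2real ?S"
      by auto
  qed simp
qed

lemma norm_force_le:
  assumes "k \<in> Ks \<union> Ku" "0 \<le> s"
  shows "norm (blinfun_apply (P k s) (f s x)) \<le> \<nu> k s"
proof -
  have "ennreal (norm (blinfun_apply (P k s) (f s x))) \<le> sup_norm (\<lambda>x. blinfun_apply (P k s) (f s x))"
    unfolding sup_norm_def by (rule SUP_upper) simp
  also have "\<dots> \<le> ennreal (\<nu> k s)"
    using assms by (rule f_bound)
  finally show ?thesis
    using \<nu>_nonneg[OF assms] by simp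
qed

lemma P_idem: "k \<in> Ks \<union> Ku \<Longrightarrow> 0 \<le> s \<Longrightarrow> blinfun_apply (P k s) (blinfun_apply (P k s) x) = blinfun_apply (P k s) x"
  using P_proj[of k s] by (metis blinfun_apply_blinfun_compose)

text \<open>Idempotence inserts one more projection. \<open>norm_force_le\<close> has no factor
  \<open>norm (P k s)\<close>, but it is the product \<open>norm (P k s) * \<nu> k s\<close> whose
  local integrability follows from the kernel bounds.\<close>

lemma norm_force_le_P:
  assumes "k \<in> Ks \<union> Ku" "0 \<le> s"
  shows "norm (force k c s) \<le> norm (P k s) * \<nu> k s"
proof -
  have "norm (blinfun_apply (P k s) (force k c s)) \<le> norm (P k s) * norm (force k c s)"
    by (rule norm_blinfun)
  also have "\<dots> \<le> norm (P k s) * \<nu> k s"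
    unfolding force_def by (intro mult_left_mono norm_force_le assms) simp
  finally show ?thesis
    using assms by (simp add: force_def P_idem)
qed

text \<open>\<open>force\<close> already lies in the range of \<open>P k s\<close>, so
  \<open>T t s\<close> acts on it as \<open>T t s o\<^sub>L P k s\<close>. Estimating
  \<open>T t s\<close> alone would lose the integrable kernel.\<close>

lemma norm_T_force_le:
  assumes "k \<in> Ks \<union> Ku" "0 \<le> s"
  shows "norm (blinfun_apply (T t s) (force k c s)) \<le> knorm k t s * \<nu> k s"
proof -
  have "norm (blinfun_apply (T t s o\<^sub>L P k s) (force k c s)) \<le> knorm k t s * norm (force k c s)"
    unfolding knorm_def by (rule norm_blinfun)
  also have "\<dots> \<le> knorm k t s * \<nu> k s"
    unfolding force_def by (intro mult_left_mono norm_force_le assms knorm_nonneg)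
  finally show ?thesis
    using assms by (simp add: force_def P_idem)
qed

lemma norm_T_force_diff_le:
  assumes "k \<in> Ks \<union> Ku" "0 \<le> s"
  shows "norm (blinfun_apply (T t s) (force k c s) - blinfun_apply (T t s) (force k d s))
    \<le> knorm k t s * (\<mu> k s * norm (c s - d s))"
proof -
  have "norm (blinfun_apply (T t s o\<^sub>L P k s) (force k c s - force k d s))
      \<le> knorm k t s * norm (force k c s - force k d s)"
    unfolding knorm_def by (rule norm_blinfun)
  also have "\<dots> \<le> knorm k t s * (\<mu> k s * norm (c s - d s))"
    unfolding force_def by (intro mult_left_mono f_lip assms knorm_nonneg)
  finally show ?thesis
    using assms by (simp add: force_def P_idem blinfun.diff_right)
qed

lemma f_comp_continuous:
  assumes "continuous_on {0..} c"
  shows "continuous_on {0..} (\<lambda>s. f s (c s))"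
proof -
  have "continuous_on {0..} (\<lambda>s. case (s, c s) of (t, x) \<Rightarrow> f t x)"
    by (rule continuous_on_compose2[OF f_cont]) (use assms in \<open>auto intro!: continuous_intros\<close>)
  then show ?thesis by simp
qed

lemma force_measurable:
  assumes "k \<in> Ks \<union> Ku" "continuous_on {0..} c"
  shows "strongly_measurable (lebesgue_on {0..}) (force k c)"
  unfolding force_def
  by (intro strongly_measurable_blinfun_apply P_meas assms strongly_measurable_continuous_on_atLeast
      f_comp_continuous)

lemma T_force_measurable:
  assumes "k \<in> Ks \<union> Ku" "continuous_on {0..} c" "0 \<le> t"
  shows "strongly_measurable (lebesgue_on (window k t)) (\<lambda>s. blinfun_apply (T t s) (force k c s))"
  by (rule strongly_measurable_lebesgue_on_subset[of "{0..}"])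
    (use assms in \<open>auto intro!: strongly_measurable_blinfun_apply strongly_measurable_T force_measurable
       window_subset window_lebesgue\<close>)

lemma T_force_integrable:
  assumes "k \<in> Ks \<union> Ku" "continuous_on {0..} c" "0 \<le> t"
  shows "(\<lambda>s. blinfun_apply (T t s) (force k c s)) integrable_on window k t"
proof (rule strongly_measurable_integrable_on[OF T_force_measurable[OF assms] window_lebesgue])
  show "(\<lambda>s. knorm k t s * \<nu> k s) integrable_on window k t"
    using knorm_\<nu>[OF assms(1)] assms(3) by auto
  show "norm (blinfun_apply (T t s) (force k c s)) \<le> knorm k t s * \<nu> k s" if "s \<in> window k t" for s
    using assms that window_subset by (intro norm_T_force_le) auto
qed

lemma green_bounded: "\<exists>D\<ge>0. \<forall>c t. continuous_on {0..} c \<longrightarrow> 0 \<le> t \<longrightarrow> norm (green c t) \<le> D"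
proof -
  have "\<forall>k\<in>Ks \<union> Ku. \<exists>D. D \<ge> 0 \<and> (\<forall>t\<ge>0. (\<lambda>s. knorm k t s * \<nu> k s) integrable_on window k t
    \<and> integral (window k t) (\<lambda>s. knorm k t s * \<nu> k s) \<le> D)"
    using knorm_\<nu> by blast
  from bchoice[OF this] obtain D where D0: "\<And>k. k \<in> Ks \<union> Ku \<Longrightarrow> 0 \<le> D k"
    and D: "\<And>k t. k \<in> Ks \<union> Ku \<Longrightarrow> 0 \<le> t \<Longrightarrow> (\<lambda>s. knorm k t s * \<nu> k s) integrable_on window k t"
    "\<And>k t. k \<in> Ks \<union> Ku \<Longrightarrow> 0 \<le> t \<Longrightarrow> integral (window k t) (\<lambda>s. knorm k t s * \<nu> k s) \<le> D k"
    by blast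
  show ?thesis
  proof (intro exI[of _ "sum D (Ks \<union> Ku)"] conjI allI impI)
    show "0 \<le> sum D (Ks \<union> Ku)"
      using D0 by (rule sum_nonneg)
    fix c :: "real \<Rightarrow> 'a" and t :: real assume c: "continuous_on {0..} c" and t: "0 \<le> t"
    show "norm (green c t) \<le> sum D (Ks \<union> Ku)"
      unfolding green_def
    proof (rule sum_norm_le)
      fix k assume k: "k \<in> Ks \<union> Ku"
      have "norm (integral (window k t) (\<lambda>s. blinfun_apply (T t s) (force k c s)))
          \<le> integral (window k t) (\<lambda>s. knorm k t s * \<nu> k s)"
        using k c t window_subset[OF t]
        by (intro integral_norm_bound_integral T_force_integrable D norm_T_force_le) auto
      also have "\<dots> \<le> D k"
        using k t by (rule D)
      finally show "norm ((if k \<in> Ks then 1 else - 1) *\<^sub>R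
          integral (window k t) (\<lambda>s. blinfun_apply (T t s) (force k c s))) \<le> D k"
        by simp
    qed
  qed
qed

text \<open>The kernel integral against \<open>\<mu>\<close> is at most \<open>lam k\<close> at
  every time. \<open>B\<close> has to bound the difference on all of \<open>{0..}\<close> because
  the unstable integrals see the whole future of the curves.\<close>

lemma green_contraction:
  assumes c: "continuous_on {0..} c" and d: "continuous_on {0..} d" and t: "0 \<le> t"
    and B: "\<And>s. 0 \<le> s \<Longrightarrow> norm (c s - d s) \<le> B"
  shows "norm (green c t - green d t) \<le> (\<Sum>k\<in>Ks \<union> Ku. lam k) * B"
proof -
  have B0: "0 \<le> B"
    using B[of 0] norm_ge_zero order_trans by blast
  let ?I = "\<lambda>k c. integral (window k t) (\<lambda>s. blinfun_apply (T t s) (force k c s))"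
  have "green c t - green d t = (\<Sum>k\<in>Ks \<union> Ku. (if k \<in> Ks then 1 else - 1) *\<^sub>R (?I k c - ?I k d))"
    unfolding green_def by (simp add: sum_subtractf scaleR_diff_right)
  also have "norm \<dots> \<le> (\<Sum>k\<in>Ks \<union> Ku. lam k * B)"
  proof (rule sum_norm_le)
    fix k assume k: "k \<in> Ks \<union> Ku"
    have diff: "?I k c - ?I k d = integral (window k t)
        (\<lambda>s. blinfun_apply (T t s) (force k c s) - blinfun_apply (T t s) (force k d s))"
      using k c d t by (intro integral_diff[symmetric] T_force_integrable)
    have "norm (?I k c - ?I k d) \<le> integral (window k t) (\<lambda>s. (knorm k t s * \<mu> k s) * B)"
      unfolding diff
    proof (rule integral_norm_bound_integral)
      show "(\<lambda>s. (knorm k t s * \<mu> k s) * B) integrable_on window k t"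
        using knorm_\<mu>[OF k t] by (intro integrable_on_mult_left)
      show "norm (blinfun_apply (T t s) (force k c s) - blinfun_apply (T t s) (force k d s))
          \<le> (knorm k t s * \<mu> k s) * B" if "s \<in> window k t" for s
      proof -
        have s: "0 \<le> s" using that window_subset[OF t] by auto
        have "knorm k t s * (\<mu> k s * norm (c s - d s)) \<le> knorm k t s * (\<mu> k s * B)"
          using k s by (intro mult_left_mono B knorm_nonneg \<mu>_nonneg) auto
        from order_trans[OF norm_T_force_diff_le[OF k s, where c=c and d=d and t=t] this] show ?thesis
          by (simp add: mult.assoc)
      qed
    qed (use k c d t in \<open>intro integrable_diff T_force_integrable; simp\<close>)
    also have "\<dots> = integral (window k t) (\<lambda>s. knorm k t s * \<mu> k s) * B"
      by simp
    also have "\<dots> \<le> lam k * B"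
      using knorm_\<mu>[OF k t] B0 by (intro mult_right_mono)
    finally show "norm ((if k \<in> Ks then 1 else - 1) *\<^sub>R (?I k c - ?I k d)) \<le> lam k * B"
      by simp
  qed
  finally show ?thesis
    by (simp add: sum_distrib_right)
qed

lemma green_cong:
  assumes "\<And>s. 0 \<le> s \<Longrightarrow> c s = d s" "0 \<le> t"
  shows "green c t = green d t"
  unfolding green_def
  using window_subset[OF assms(2)] assms(1)
  by (intro sum.cong refl arg_cong2[where f=scaleR] integral_cong) (auto simp: force_def subset_iff)

text \<open>\<open>P k s\<close> is recovered from the kernel by the backward evolution, as
  \<open>T s \<tau>\<close> after \<open>T \<tau> s o\<^sub>L P k s\<close>, and
  \<open>T s \<tau>\<close> is bounded on \<open>{0..N}\<close>. Used with \<open>\<nu>\<close> for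
  the forcing and with \<open>\<mu>\<close> for its Lipschitz constant.\<close>

lemma P_locally_integrable:
  assumes k: "k \<in> Ks \<union> Ku" and N: "0 \<le> N"
    and \<psi>: "\<psi> \<in> borel_measurable (restrict_space borel {0..})" "\<And>s. 0 \<le> s \<Longrightarrow> 0 \<le> \<psi> s"
    and int: "\<And>t. 0 \<le> t \<Longrightarrow> (\<lambda>s. knorm k t s * \<psi> s) integrable_on window k t"
  shows "(\<lambda>s. norm (P k s) * \<psi> s) integrable_on {0..N}"
proof -
  \<comment> \<open>The reference time whose window covers all of \<open>{0..N}\<close>: the right
    endpoint for a stable index, the left one for an unstable index.\<close>
  define \<tau> where "\<tau> = (if k \<in> Ks then N else 0)"
  have \<tau>: "\<tau> \<in> {0..N}" and sub: "{0..N} \<subseteq> window k \<tau>"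
    using N by (auto simp: \<tau>_def window_def)
  obtain C where C: "C > 0" "\<And>p q. p \<in> {0..N} \<Longrightarrow> q \<in> {0..N} \<Longrightarrow> norm (T p q) \<le> C"
    using T_bounded[of N] by blast
  show ?thesis
  proof (rule measurable_bounded_by_integrable_imp_integrable_real)
    have "\<psi> \<in> borel_measurable (lebesgue_on {0..})"
      using \<psi>(1) by (rule borel_measurable_lebesgue_on_if_borel) simp
    moreover have "(\<lambda>s. norm (P k s)) \<in> borel_measurable (lebesgue_on {0..})"
      by (intro borel_measurable_strongly_measurable strongly_measurable_norm P_meas k) simp
    ultimately have "(\<lambda>s. norm (P k s) * \<psi> s) \<in> borel_measurable (lebesgue_on {0..})"
      by (intro borel_measurable_times)
    then show "(\<lambda>s. norm (P k s) * \<psi> s) \<in> borel_measurable (lebesgue_on {0..N})"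
      by (rule measurable_restrict_mono) auto
    show "(\<lambda>s. C * (knorm k \<tau> s * \<psi> s)) integrable_on {0..N}"
      using int \<tau> by (intro integrable_on_mult_right integrable_on_subinterval[OF _ sub]) auto
    show "\<bar>norm (P k s) * \<psi> s\<bar> \<le> C * (knorm k \<tau> s * \<psi> s)" if s: "s \<in> {0..N}" for s
    proof -
      have "P k s = T s \<tau> o\<^sub>L (T \<tau> s o\<^sub>L P k s)"
        using s \<tau> by (intro blinfun_eqI) (simp add: T_apply_T T_refl)
      then have "norm (P k s) \<le> norm (T s \<tau>) * knorm k \<tau> s"
        unfolding knorm_def by (metis norm_blinfun_compose)
      also have "\<dots> \<le> C * knorm k \<tau> s"
        using s \<tau> by (intro mult_right_mono C knorm_nonneg)
      finally have "norm (P k s) * \<psi> s \<le> C * knorm k \<tau> s * \<psi> s"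
        using s \<psi>(2) by (intro mult_right_mono) auto
      then show ?thesis
        using s \<psi>(2) by (simp add: mult.assoc abs_mult)
    qed
  qed simp
qed

text \<open>A locally integrable bound for the total stable and unstable forcing, the same for every
  curve \<open>c\<close>.\<close>

definition majorant :: "real \<Rightarrow> real" where
  "majorant s = (\<Sum>k\<in>Ks \<union> Ku. norm (P k s) * \<nu> k s)"

lemma majorant_integrable: "0 \<le> N \<Longrightarrow> majorant integrable_on {0..N}"
  unfolding majorant_def[abs_def]
  using knorm_\<nu> \<nu>_meas \<nu>_nonneg K_fin by (intro integrable_sum P_locally_integrable) blast+

lemma norm_sum_force_le: "0 \<le> s \<Longrightarrow> norm (\<Sum>k\<in>Ks \<union> Ku. force k c s) \<le> majorant s"
  unfolding majorant_def by (intro sum_norm_le norm_force_le_P) auto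

lemma sum_force_measurable:
  "continuous_on {0..} c \<Longrightarrow> strongly_measurable (lebesgue_on {0..}) (\<lambda>s. \<Sum>k\<in>Ks \<union> Ku. force k c s)"
  by (intro strongly_measurable_sum force_measurable)

text \<open>Since \<open>T t s\<close> factors through time 0, \<open>T t 0\<close> can be pulled
  out of every integral. For an unstable index, the integral from \<open>t\<close> to infinity is
  the one from 0 minus the one over \<open>{0..t}\<close>; the former is the constant
  \<open>q k\<close>, and the latter joins the stable integrals. This is the shape required by
  \<open>duhamel\<close>.\<close>

lemma green_eq:
  assumes c: "continuous_on {0..} c"
  shows "\<exists>w0. \<forall>t\<ge>0. green c t = blinfun_apply (T t 0)
    (w0 + integral {0..t} (\<lambda>s. blinfun_apply (T 0 s) (\<Sum>k\<in>Ks \<union> Ku. force k c s)))"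
proof -
  define q where "q k = (if k \<in> Ks then 0 else - integral {0..} (\<lambda>s. blinfun_apply (T 0 s) (force k c s)))" for k
  let ?G = "\<lambda>k s. blinfun_apply (T 0 s) (force k c s)"
  have G_window: "?G k integrable_on window k t" if k: "k \<in> Ks \<union> Ku" and t: "0 \<le> t" for k t
  proof -
    have "(blinfun_apply (T 0 t) \<circ> (\<lambda>s. blinfun_apply (T t s) (force k c s))) integrable_on window k t"
      by (intro integrable_linear T_force_integrable k c t blinfun.bounded_linear_right)
    then show ?thesis
      by (rule integrable_eq) (use t window_subset[OF t, of k] in \<open>auto simp: T_apply_T\<close>)
  qed
  have G_Icc: "?G k integrable_on {0..t}" if k: "k \<in> Ks \<union> Ku" and t: "0 \<le> t" for k t
  proof (cases "k \<in> Ks")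
    case True
    then show ?thesis using G_window[OF k t] by (simp add: window_def)
  next
    case False
    then have "?G k integrable_on {0..}" using G_window[OF k, of 0] by (simp add: window_def)
    then show ?thesis by (rule integrable_on_subinterval) auto
  qed
  have term_eq: "(if k \<in> Ks then 1 else - 1) *\<^sub>R integral (window k t) (\<lambda>s. blinfun_apply (T t s) (force k c s))
      = blinfun_apply (T t 0) (q k + integral {0..t} (?G k))" if k: "k \<in> Ks \<union> Ku" and t: "0 \<le> t" for k t
  proof -
    have "integral (window k t) (\<lambda>s. blinfun_apply (T t s) (force k c s))
        = integral (window k t) (blinfun_apply (T t 0) \<circ> ?G k)"
      using t window_subset[OF t, of k] by (intro integral_cong) (auto simp: T_apply_T)
    also have "\<dots> = blinfun_apply (T t 0) (integral (window k t) (?G k))"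
      by (intro integral_linear G_window k t blinfun.bounded_linear_right)
    finally have eq: "integral (window k t) (\<lambda>s. blinfun_apply (T t s) (force k c s))
      = blinfun_apply (T t 0) (integral (window k t) (?G k))" .
    show ?thesis
    proof (cases "k \<in> Ks")
      case True
      then show ?thesis by (simp add: eq q_def) (simp add: window_def)
    next
      case False
      have "(?G k has_integral integral {0..t} (?G k) + integral {t..} (?G k)) ({0..t} \<union> {t..})"
      proof (rule has_integral_Un)
        show "(?G k has_integral integral {t..} (?G k)) {t..}"
          using G_window[OF k t] False by (simp add: window_def integrable_integral)
        have "{0..t} \<inter> {t..} = {t}" using t by auto
        then show "negligible ({0..t} \<inter> {t..})" by simp
      qed (rule integrable_integral[OF G_Icc[OF k t]])
      moreover have "{0..t} \<union> {t..} = {0..}" using t by auto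
      ultimately have "integral {0..} (?G k) = integral {0..t} (?G k) + integral {t..} (?G k)"
        by (simp add: integral_unique)
      then have "- integral (window k t) (?G k) = q k + integral {0..t} (?G k)"
        using False by (simp add: q_def window_def)
      then show ?thesis
        using False by (simp add: eq blinfun.minus_right[symmetric])
    qed
  qed
  show ?thesis
  proof (intro exI[of _ "sum q (Ks \<union> Ku)"] allI impI)
    fix t :: real assume t: "0 \<le> t"
    have "integral {0..t} (\<lambda>s. blinfun_apply (T 0 s) (\<Sum>k\<in>Ks \<union> Ku. force k c s))
        = (\<Sum>k\<in>Ks \<union> Ku. integral {0..t} (?G k))"
      unfolding blinfun.sum_right
      by (rule Henstock_Kurzweil_Integration.integral_sum[OF K_fin G_Icc[OF _ t]])
    then show "green c t = blinfun_apply (T t 0)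
      (sum q (Ks \<union> Ku) + integral {0..t} (\<lambda>s. blinfun_apply (T 0 s) (\<Sum>k\<in>Ks \<union> Ku. force k c s)))"
      unfolding green_def using term_eq[OF _ t]
      by (simp add: sum.distrib[symmetric] blinfun.sum_right)
  qed
qed

lemma green_solution:
  assumes c: "continuous_on {0..} c"
  shows "continuous_on {0..} (green c)"
    and "\<And>s t. 0 \<le> s \<Longrightarrow> s \<le> t \<Longrightarrow> ((\<lambda>r. blinfun_apply (A r) (green c r) + (\<Sum>k\<in>Ks \<union> Ku. force k c r))
      has_integral (green c t - green c s)) {s..t}"
proof -
  obtain w0 where w0: "\<And>t. 0 \<le> t \<Longrightarrow> green c t = blinfun_apply (T t 0)
    (w0 + integral {0..t} (\<lambda>s. blinfun_apply (T 0 s) (\<Sum>k\<in>Ks \<union> Ku. force k c s)))"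
    using green_eq[OF c] by blast
  note D = duhamel[OF sum_force_measurable[OF c] majorant_integrable norm_sum_force_le w0]
  show "continuous_on {0..} (green c)" by (rule D)
  show "((\<lambda>r. blinfun_apply (A r) (green c r) + (\<Sum>k\<in>Ks \<union> Ku. force k c r))
      has_integral (green c t - green c s)) {s..t}" if "0 \<le> s" "s \<le> t" for s t
    by (rule D(2)[OF _ _ _ that])
qed

text \<open>The right-hand side of the equation for \<open>green c\<close> is at most
  \<open>a * D + majorant r\<close>, whatever \<open>c\<close> is, so one primitive \<open>M\<close>
  of this bound controls the increments for all curves at once.\<close>

lemma green_equicontinuous:
  "\<exists>M. continuous_on {0..N} M \<and> (\<forall>c. continuous_on {0..} c \<longrightarrow>
    (\<forall>s\<in>{0..N}. \<forall>t\<in>{0..N}. norm (green c t - green c s) \<le> \<bar>M t - M s\<bar>))"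
proof (cases "0 \<le> N")
  case N: True
  obtain a where a: "a \<ge> 0" "\<And>t. t \<in> {0..N} \<Longrightarrow> norm (A t) \<le> a"
    using A_bounded[of N] by blast
  obtain D where D: "D \<ge> 0" "\<And>c t. continuous_on {0..} c \<Longrightarrow> 0 \<le> t \<Longrightarrow> norm (green c t) \<le> D"
    using green_bounded by blast
  define m where "m r = a * D + majorant r" for r
  have m: "m integrable_on {0..N}"
    unfolding m_def using majorant_integrable[OF N] by (intro integrable_add) auto
  define M where "M t = integral {0..t} m" for t
  have le: "norm (green c t - green c s) \<le> M t - M s"
    if c: "continuous_on {0..} c" and st: "0 \<le> s" "s \<le> t" "t \<le> N" for c s t
  proof -
    have m0t: "m integrable_on {0..t}" and mst: "m integrable_on {s..t}"
      by (rule integrable_on_subinterval[OF m]; use st in auto)+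
    note G = green_solution(2)[OF c st(1,2)]
    have "norm (integral {s..t} (\<lambda>r. blinfun_apply (A r) (green c r) + (\<Sum>k\<in>Ks \<union> Ku. force k c r)))
      \<le> integral {s..t} m"
    proof (rule integral_norm_bound_integral[OF has_integral_integrable[OF G] mst])
      fix r assume r: "r \<in> {s..t}"
      have "norm (blinfun_apply (A r) (green c r)) \<le> norm (A r) * norm (green c r)"
        by (rule norm_blinfun)
      also have "\<dots> \<le> a * D"
        using r st c a D by (intro mult_mono) auto
      finally show "norm (blinfun_apply (A r) (green c r) + (\<Sum>k\<in>Ks \<union> Ku. force k c r)) \<le> m r"
        unfolding m_def using norm_sum_force_le[of r c] r st by (intro norm_triangle_mono) auto
    qed
    then show ?thesis
      using Henstock_Kurzweil_Integration.integral_combine[OF st(1,2) m0t]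
      by (simp add: M_def integral_unique[OF G])
  qed
  show ?thesis
  proof (intro exI[of _ M] conjI allI impI ballI)
    show "continuous_on {0..N} M"
      unfolding M_def by (rule indefinite_integral_continuous_1[OF m])
    fix c :: "real \<Rightarrow> 'a" and s t assume "continuous_on {0..} c" "s \<in> {0..N}" "t \<in> {0..N}"
    then show "norm (green c t - green c s) \<le> \<bar>M t - M s\<bar>"
      using le[of c s t] le[of c t s] by (cases "s \<le> t") (auto simp: norm_minus_commute)
  qed
qed auto

text \<open>The integrands converge pointwise by continuity of \<open>f\<close>, and their
  differences are dominated by \<open>2 * (knorm t s * \<nu> s)\<close> (index \<open>k\<close>
  understood), independently of the curves. No uniform closeness of the curves on the infinite
  window is required.\<close>

lemma green_tendsto_fixed_time:
  assumes cn: "\<And>n. continuous_on {0..} (cn n)" and c: "continuous_on {0..} c"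
    and lim: "\<And>s. 0 \<le> s \<Longrightarrow> (\<lambda>n. cn n s) \<longlonglongrightarrow> c s" and t: "0 \<le> t"
  shows "(\<lambda>n. green (cn n) t) \<longlonglongrightarrow> green c t"
  unfolding green_def
proof (intro tendsto_sum tendsto_scaleR tendsto_const)
  fix k assume k: "k \<in> Ks \<union> Ku"
  let ?F = "\<lambda>c s. blinfun_apply (T t s) (force k c s)"
  let ?W = "window k t"
  have int: "?F c integrable_on ?W" "\<And>n. ?F (cn n) integrable_on ?W"
    using k c cn t by (auto intro: T_force_integrable)
  have kint: "(\<lambda>s. 2 * (knorm k t s * \<nu> k s)) integrable_on ?W"
    using knorm_\<nu>[OF k] t by (intro integrable_on_mult_right) auto
  have bound: "norm (?F (cn n) s - ?F c s) \<le> 2 * (knorm k t s * \<nu> k s)" if "s \<in> ?W" for n s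
  proof -
    have "0 \<le> s" using that window_subset[OF t] by auto
    then show ?thesis
      using norm_T_force_le[OF k, of s t "cn n"] norm_T_force_le[OF k, of s t c]
        norm_triangle_ineq4[of "?F (cn n) s" "?F c s"] by linarith
  qed
  have dint: "(\<lambda>s. norm (?F (cn n) s - ?F c s)) integrable_on ?W" for n
  proof (rule measurable_bounded_by_integrable_imp_integrable_real[OF _ kint _ window_lebesgue])
    show "(\<lambda>s. norm (?F (cn n) s - ?F c s)) \<in> borel_measurable (lebesgue_on ?W)"
      using T_force_measurable[OF k cn t] T_force_measurable[OF k c t]
      by (intro borel_measurable_strongly_measurable[OF _ window_lebesgue]
          strongly_measurable_compose2[where p="\<lambda>x y. norm (x - y)"])
        (auto simp: split_beta intro!: continuous_intros)
  qed (use bound in simp)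
  \<comment> \<open>Dominated convergence is applied to the real norms of the differences; their
    integrals then bound the Banach-valued differences.\<close>
  have "(\<lambda>n. integral ?W (\<lambda>s. norm (?F (cn n) s - ?F c s))) \<longlonglongrightarrow> integral ?W (\<lambda>s. 0)"
  proof (rule dominated_convergence(2)[OF dint kint])
    show "norm (norm (?F (cn n) s - ?F c s)) \<le> 2 * (knorm k t s * \<nu> k s)" if "s \<in> ?W" for n s
      using bound[OF that] by simp
    show "(\<lambda>n. norm (?F (cn n) s - ?F c s)) \<longlonglongrightarrow> 0" if "s \<in> ?W" for s
    proof -
      have s: "0 \<le> s" using that window_subset[OF t] by auto
      have "(\<lambda>n. (s, cn n s)) \<longlonglongrightarrow> (s, c s)"
        using lim[OF s] by (intro tendsto_intros)
      from continuous_on_tendsto_compose[OF f_cont this] s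
      have "(\<lambda>n. f s (cn n s)) \<longlonglongrightarrow> f s (c s)" by simp
      then have "(\<lambda>n. ?F (cn n) s) \<longlonglongrightarrow> ?F c s"
        unfolding force_def by (intro blinfun.tendsto tendsto_const)
      then show ?thesis
        by (simp add: LIM_zero tendsto_norm_zero)
    qed
  qed
  then have lim0: "(\<lambda>n. integral ?W (\<lambda>s. norm (?F (cn n) s - ?F c s))) \<longlonglongrightarrow> 0"
    by simp
  have "norm (integral ?W (?F (cn n)) - integral ?W (?F c)) \<le> integral ?W (\<lambda>s. norm (?F (cn n) s - ?F c s))" for n
    unfolding integral_diff[OF int(2) int(1), symmetric]
    by (rule integral_norm_bound_integral[OF integrable_diff[OF int(2) int(1)] dint]) simp
  then show "(\<lambda>n. integral ?W (?F (cn n))) \<longlonglongrightarrow> integral ?W (?F c)"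
    by (intro LIM_zero_cancel[OF Lim_null_comparison[OF _ lim0]]) auto
qed

text \<open>The change of time from \<open>tn n\<close> to \<open>t\<close> is controlled by the
  modulus shared by all curves, which leaves the convergence at the fixed time
  \<open>t\<close>.\<close>

lemma green_tendsto:
  assumes cn: "\<And>n. continuous_on {0..} (cn n)" and c: "continuous_on {0..} c"
    and lim: "\<And>s. 0 \<le> s \<Longrightarrow> (\<lambda>n. cn n s) \<longlonglongrightarrow> c s"
    and tn: "\<And>n. 0 \<le> tn n" "tn \<longlonglongrightarrow> t" and t: "0 \<le> t"
  shows "(\<lambda>n. green (cn n) (tn n)) \<longlonglongrightarrow> green c t"
proof -
  obtain M where M: "continuous_on {0..t+1} M"
    "\<And>c p q. continuous_on {0..} c \<Longrightarrow> p \<in> {0..t+1} \<Longrightarrow> q \<in> {0..t+1} \<Longrightarrow> norm (green c q - green c p) \<le> \<bar>M q - M p\<bar>"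
    using green_equicontinuous[of "t+1"] by blast
  have ev: "\<forall>\<^sub>F n in sequentially. tn n \<in> {0..t+1}"
    using order_tendstoD(2)[OF tn(2), of "t+1"] by (auto elim!: eventually_mono simp: tn(1) less_imp_le)
  have "(\<lambda>n. M (tn n)) \<longlonglongrightarrow> M t"
    by (rule continuous_on_tendsto_compose[OF M(1) tn(2) _ ev]) (use t in simp)
  then have "(\<lambda>n. \<bar>M (tn n) - M t\<bar>) \<longlonglongrightarrow> 0"
    by (simp add: LIM_zero tendsto_rabs_zero)
  then have "(\<lambda>n. green (cn n) (tn n) - green (cn n) t) \<longlonglongrightarrow> 0"
    by (rule Lim_null_comparison[rotated]) (use ev t in \<open>auto elim!: eventually_mono intro!: M(2) cn\<close>)
  from tendsto_add[OF this green_tendsto_fixed_time[OF cn c lim t]] show ?thesis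
    by simp
qed

text \<open>The unknown is the bounded deviation from the linear trajectory, for all initial values
  \<open>\<xi>\<close> at time 0 simultaneously. In this complete space the fixed point is jointly
  continuous in \<open>(t, \<xi>)\<close>, so no separate parameter-dependence argument is
  required.\<close>

lemma fixed_point:
  "\<exists>\<eta> :: (real \<times> 'a) \<Rightarrow>\<^sub>C 'a. \<forall>t\<ge>0. \<forall>\<xi>.
     apply_bcontfun \<eta> (t, \<xi>) = green (\<lambda>s. blinfun_apply (T s 0) \<xi> + apply_bcontfun \<eta> (s, \<xi>)) t"
proof -
  define traj :: "((real \<times> 'a) \<Rightarrow>\<^sub>C 'a) \<Rightarrow> 'a \<Rightarrow> real \<Rightarrow> 'a"
    where "traj \<eta> \<xi> s = blinfun_apply (T s 0) \<xi> + apply_bcontfun \<eta> (s, \<xi>)" for \<eta> \<xi> s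
  have traj_cont: "continuous_on {0..} (traj \<eta> \<xi>)" for \<eta> \<xi>
    unfolding traj_def
    by (intro continuous_on_add blinfun.continuous_on T_continuous_fst continuous_on_const
        continuous_on_compose2[OF continuous_on_apply_bcontfun[of UNIV]] continuous_on_Pair continuous_on_id) auto
  obtain D where D: "D \<ge> 0" "\<And>c t. continuous_on {0..} c \<Longrightarrow> 0 \<le> t \<Longrightarrow> norm (green c t) \<le> D"
    using green_bounded by blast
  \<comment> \<open>\<open>max 0 t\<close> extends the values constantly to negative times, since
    elements of the space are functions on the whole real line.\<close>
  define \<Psi> where "\<Psi> \<eta> = Bcontfun (\<lambda>(t, \<xi>). green (traj \<eta> \<xi>) (max 0 t))" for \<eta>
  have \<Psi>: "apply_bcontfun (\<Psi> \<eta>) (t, \<xi>) = green (traj \<eta> \<xi>) (max 0 t)" for \<eta> t and \<xi> :: 'a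
  proof -
    have "(\<lambda>(t, \<xi>). green (traj \<eta> \<xi>) (max 0 t)) \<in> bcontfun"
    proof (rule bcontfun_normI)
      show "norm (case z of (t, \<xi>) \<Rightarrow> green (traj \<eta> \<xi>) (max 0 t)) \<le> D" for z
        by (auto simp: split_beta intro!: D traj_cont)
      show "continuous_on UNIV (\<lambda>(t, \<xi>). green (traj \<eta> \<xi>) (max 0 t))"
        unfolding continuous_on_sequentially comp_def
      proof (intro allI ballI impI, elim conjE)
        fix x :: "nat \<Rightarrow> real \<times> 'a" and a assume x: "x \<longlonglongrightarrow> a"
        have "(\<lambda>n. green (traj \<eta> (snd (x n))) (max 0 (fst (x n)))) \<longlonglongrightarrow> green (traj \<eta> (snd a)) (max 0 (fst a))"
        proof (rule green_tendsto)
          show "(\<lambda>n. traj \<eta> (snd (x n)) s) \<longlonglongrightarrow> traj \<eta> (snd a) s" if "0 \<le> s" for s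
            unfolding traj_def
            by (intro tendsto_add blinfun.tendsto tendsto_const tendsto_snd x
                continuous_on_tendsto_compose[OF continuous_on_apply_bcontfun[of UNIV]] tendsto_Pair) auto
          show "(\<lambda>n. max 0 (fst (x n))) \<longlonglongrightarrow> max 0 (fst a)"
            by (intro tendsto_intros x)
        qed (auto intro: traj_cont)
        then show "(\<lambda>n. case x n of (t, \<xi>) \<Rightarrow> green (traj \<eta> \<xi>) (max 0 t)) \<longlonglongrightarrow> (case a of (t, \<xi>) \<Rightarrow> green (traj \<eta> \<xi>) (max 0 t))"
          by (simp add: split_beta)
      qed
    qed
    then show ?thesis
      by (simp add: \<Psi>_def Bcontfun_inverse)
  qed
  let ?L = "\<Sum>k\<in>Ks \<union> Ku. lam k"
  have "\<exists>!\<eta>. \<Psi> \<eta> = \<eta>"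
  proof (rule banach_fix_type)
    show "0 \<le> ?L" using lam_pos by (intro sum_nonneg) (auto intro: less_imp_le)
    show "?L < 1" by (rule lam_sum)
    show "\<forall>\<eta> \<zeta>. dist (\<Psi> \<eta>) (\<Psi> \<zeta>) \<le> ?L * dist \<eta> \<zeta>"
    proof (intro allI dist_bound)
      fix \<eta> \<zeta> :: "(real \<times> 'a) \<Rightarrow>\<^sub>C 'a" and z :: "real \<times> 'a"
      obtain t \<xi> where z: "z = (t, \<xi>)" by (cases z)
      have "norm (green (traj \<eta> \<xi>) (max 0 t) - green (traj \<zeta> \<xi>) (max 0 t)) \<le> ?L * dist \<eta> \<zeta>"
      proof (rule green_contraction[OF traj_cont traj_cont])
        show "norm (traj \<eta> \<xi> s - traj \<zeta> \<xi> s) \<le> dist \<eta> \<zeta>" for s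
          using dist_bounded[of \<eta> "(s, \<xi>)" \<zeta>] by (simp add: traj_def dist_norm)
      qed simp
      then show "dist (apply_bcontfun (\<Psi> \<eta>) z) (apply_bcontfun (\<Psi> \<zeta>) z) \<le> ?L * dist \<eta> \<zeta>"
        by (simp add: z \<Psi> dist_norm)
    qed
  qed
  then obtain \<eta> where "\<Psi> \<eta> = \<eta>" by blast
  then have "apply_bcontfun \<eta> (t, \<xi>) = green (traj \<eta> \<xi>) t" if "0 \<le> t" for t and \<xi> :: 'a
    using \<Psi>[of \<eta> t \<xi>] that by simp
  then show ?thesis
    unfolding traj_def by blast
qed

end

section \<open>Conjugacy along the nonlinear flow\<close>

locale trichotomy_flow = trichotomy_perturbation A T f Ks Ku P \<mu> \<nu> lam
  for A :: "real \<Rightarrow> 'a::banach \<Rightarrow>\<^sub>L 'a" and T :: "real \<Rightarrow> real \<Rightarrow> 'a \<Rightarrow>\<^sub>L 'a"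
    and f :: "real \<Rightarrow> 'a \<Rightarrow> 'a" and Ks Ku :: "'k set" and P :: "'k \<Rightarrow> real \<Rightarrow> 'a \<Rightarrow>\<^sub>L 'a"
    and \<mu> \<nu> :: "'k \<Rightarrow> real \<Rightarrow> real" and lam :: "'k \<Rightarrow> real" +
  fixes U :: "real \<Rightarrow> real \<Rightarrow> 'a \<Rightarrow> 'a" and Kc :: "'k set"
  assumes U: "evolution_family (\<lambda>t x. blinfun_apply (A t) x + f t x) U"
    and Kc_fin: "finite Kc"
    and Kc_disj: "(Ks \<union> Ku) \<inter> Kc = {}"
    and P_sum: "\<And>t. 0 \<le> t \<Longrightarrow> (\<Sum>k\<in>Ks \<union> Ku \<union> Kc. P k t) = id_blinfun"
    and Pc_meas: "\<And>k. k \<in> Kc \<Longrightarrow> strongly_measurable (lebesgue_on {0..}) (P k)"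
begin

abbreviation rhs :: "real \<Rightarrow> 'a \<Rightarrow> 'a" where
  "rhs t x \<equiv> blinfun_apply (A t) x + f t x"

section \<open>The nonlinear evolution and its dependence on the initial data\<close>

lemma U_solution: "s \<ge> 0 \<Longrightarrow> classical_solution rhs (\<lambda>t. U t s v)"
  using U by (simp add: evolution_family_def)

lemma U_refl: "s \<ge> 0 \<Longrightarrow> U s s v = v"
  using U by (simp add: evolution_family_def)

lemma solution_eq_U: "classical_solution rhs x \<Longrightarrow> s \<ge> 0 \<Longrightarrow> t \<ge> 0 \<Longrightarrow> x t = U t s (x s)"
  using U by (simp add: evolution_family_def)

lemma U_apply_U: "t \<ge> 0 \<Longrightarrow> s \<ge> 0 \<Longrightarrow> r \<ge> 0 \<Longrightarrow> U t s (U s r v) = U t r v"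
  using solution_eq_U[OF U_solution[of r v], of s t] by (simp only:)

lemma U_continuous_time: "s \<ge> 0 \<Longrightarrow> continuous_on {0..} (\<lambda>t. U t s v)"
  by (intro classical_solution_continuous[OF U_solution])

lemma rhs_continuous: "continuous_on ({0..} \<times> UNIV) (\<lambda>(t, x). rhs t x)"
proof -
  have "continuous_on ({0..} \<times> UNIV) (\<lambda>z. blinfun_apply (A (fst z)) (snd z) + (case z of (t, x) \<Rightarrow> f t x))"
    by (intro continuous_on_add blinfun.continuous_on f_cont continuous_on_snd
        continuous_on_compose2[OF A_cont] continuous_on_fst continuous_on_id) auto
  then show ?thesis
    by (simp add: split_beta)
qed

lemma solution_increment_le:
  assumes x: "classical_solution rhs x" and st: "0 \<le> s" "0 \<le> t"
    and B: "\<And>r. r \<in> closed_segment s t \<Longrightarrow> norm (rhs r (x r)) \<le> B"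
  shows "norm (x t - x s) \<le> B * \<bar>t - s\<bar>"
proof -
  have B0: "0 \<le> B"
    by (rule order_trans[OF norm_ge_zero B[OF ends_in_segment(1)]])
  have le: "norm (x q - x p) \<le> B * \<bar>q - p\<bar>"
    if "0 \<le> p" "p \<le> q" "\<And>r. r \<in> {p..q} \<Longrightarrow> norm (rhs r (x r)) \<le> B" for p q
  proof -
    have "norm (x q - x p) \<le> B * measure lborel (cbox p q)"
      by (rule has_integral_bound[OF B0])
        (use classical_solution_has_integral[OF x that(1,2)] that(3) in auto)
    then show ?thesis using that by simp
  qed
  show ?thesis
    using le[of s t] le[of t s] st B
    by (cases "s \<le> t") (auto simp: closed_segment_eq_real_ivl norm_minus_commute abs_minus_commute)
qed

text \<open>Continuity of \<open>rhs\<close> bounds the velocity near \<open>(t, v)\<close>, so a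
  solution starting nearby cannot leave a small ball during a short time. Neither a Lipschitz
  condition nor continuity of \<open>U t s\<close> enters; the lemma handles varying starting
  times.\<close>

lemma U_tendsto_diagonal:
  assumes t: "0 \<le> t" and tn: "\<And>n. 0 \<le> tn n" "tn \<longlonglongrightarrow> t" and vn: "vn \<longlonglongrightarrow> v"
  shows "(\<lambda>n. U t (tn n) (vn n)) \<longlonglongrightarrow> v"
proof (rule metric_LIMSEQ_I)
  fix e :: real assume e: "e > 0"
  define B where "B = norm (rhs t v) + 1"
  have "B > 0" by (simp add: B_def add_nonneg_pos)
  obtain \<delta> where \<delta>: "\<delta> > 0"
    "\<And>r x. 0 \<le> r \<Longrightarrow> dist (r, x) (t, v) < \<delta> \<Longrightarrow> dist (rhs r x) (rhs t v) < 1"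
  proof -
    have "(t, v) \<in> {0..} \<times> UNIV" using t by simp
    from rhs_continuous[unfolded continuous_on_iff, rule_format, OF this, of 1] show ?thesis
      using that by (auto simp: split_beta)
  qed
  \<comment> \<open>With times within \<open>\<delta> / 2\<close> of \<open>t\<close>, the bound
    \<open>\<delta> / 4\<close> in space stays inside the \<open>\<delta>\<close>-ball in which
    \<open>rhs\<close> is bounded by \<open>B\<close>.\<close>
  define \<epsilon> where "\<epsilon> = min e (\<delta> / 4)"
  have \<epsilon>: "\<epsilon> > 0" "\<epsilon> \<le> e" "\<epsilon> \<le> \<delta> / 4"
    using e \<delta>(1) by (auto simp: \<epsilon>_def)
  have rhs_le: "norm (rhs r x) \<le> B" if "0 \<le> r" "\<bar>r - t\<bar> < \<delta> / 2" "norm (x - v) \<le> \<epsilon>" for r x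
  proof -
    have "dist (r, x) (t, v) \<le> dist r t + dist x v"
      unfolding dist_Pair_Pair by (rule sqrt_sum_squares_le_sum) auto
    also have "\<dots> < \<delta>"
      using that \<epsilon>(3) \<delta>(1) by (simp add: dist_norm)
    finally have "norm (rhs r x - rhs t v) < 1"
      using \<delta>(2)[OF that(1)] by (simp add: dist_norm)
    then show ?thesis
      using norm_triangle_ineq2[of "rhs r x" "rhs t v"] by (simp add: B_def)
  qed
  \<comment> \<open>At speed at most \<open>B\<close>, a time shorter than
    \<open>\<epsilon> / (2 * B)\<close> allows a displacement of at most
    \<open>\<epsilon> / 2\<close>; the initial error takes the other half.\<close>
  have "\<forall>\<^sub>F n in sequentially. dist (tn n) t < min (\<delta> / 2) (\<epsilon> / (2 * B))"
    using tendstoD[OF tn(2), of "min (\<delta> / 2) (\<epsilon> / (2 * B))"] \<delta>(1) \<epsilon>(1) \<open>B > 0\<close> by simp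
  moreover have "\<forall>\<^sub>F n in sequentially. dist (vn n) v < \<epsilon> / 2"
    using tendstoD[OF vn, of "\<epsilon> / 2"] \<epsilon>(1) by simp
  ultimately have "\<forall>\<^sub>F n in sequentially. dist (U t (tn n) (vn n)) v < e"
  proof eventually_elim
    case (elim n)
    let ?x = "\<lambda>r. U r (tn n) (vn n)"
    \<comment> \<open>Parametrising the segment from \<open>tn n\<close> to \<open>t\<close> by
      \<open>{0..1}\<close> treats \<open>tn n < t\<close> and \<open>tn n > t\<close>
      alike.\<close>
    define \<rho> where "\<rho> \<sigma> = tn n + \<sigma> * (t - tn n)" for \<sigma>
    define d where "d \<sigma> = norm (?x (\<rho> \<sigma>) - v)" for \<sigma>
    have \<rho>_seg: "\<rho> \<sigma> \<in> closed_segment (tn n) t" if "\<sigma> \<in> {0..1}" for \<sigma>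
      using that unfolding \<rho>_def in_segment by (intro exI[of _ \<sigma>]) (auto simp: algebra_simps)
    have seg0: "0 \<le> r" "\<bar>r - t\<bar> < \<delta> / 2" if "r \<in> closed_segment (tn n) t" for r
      using that tn(1)[of n] t elim(1) by (auto simp: closed_segment_eq_real_ivl dist_real_def split: if_splits)
    have x: "classical_solution rhs ?x"
      using tn by (intro U_solution)
    have d_cont: "continuous_on {0..1} d"
      unfolding d_def
      by (intro continuous_on_norm continuous_on_diff continuous_on_const
          continuous_on_compose2[OF classical_solution_continuous[OF x]])
        (use \<rho>_seg seg0 in \<open>auto simp: \<rho>_def intro!: continuous_intros\<close>)
    have d0: "d 0 < \<epsilon> / 2"
      using elim(2) tn(1) by (simp add: d_def \<rho>_def U_refl dist_norm)
    have "d 1 < \<epsilon>"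
    proof (rule ccontr)
      assume "\<not> d 1 < \<epsilon>"
      \<comment> \<open>First-exit argument: \<open>m\<close>, the least parameter in
        \<open>S\<close>, is reached while the velocity is still bounded by \<open>B\<close>, too
        early for the distance to have become \<open>\<epsilon>\<close>.\<close>
      define S where "S = {\<sigma> \<in> {0..1}. \<epsilon> \<le> d \<sigma>}"
      have "closed ({0..1} \<inter> d -` {\<epsilon>..})"
        using d_cont by (intro continuous_closed_preimage) auto
      moreover have "{0..1} \<inter> d -` {\<epsilon>..} = S"
        by (auto simp: S_def)
      ultimately have "closed S"
        by simp
      then have "compact S"
        unfolding compact_eq_bounded_closed
        by (auto intro: bounded_subset[of "{0..1::real}"] simp: S_def)
      moreover have "S \<noteq> {}"
        using \<open>\<not> d 1 < \<epsilon>\<close> by (auto simp: S_def)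
      ultimately obtain m where m: "m \<in> S" "\<And>\<sigma>. \<sigma> \<in> S \<Longrightarrow> m \<le> \<sigma>"
        using compact_attains_inf[of S] by auto
      have m01: "m \<in> {0..1}" "\<epsilon> \<le> d m"
        using m(1) by (auto simp: S_def)
      \<comment> \<open>A value above \<open>\<epsilon>\<close> at a parameter up to
        \<open>m\<close> would, by the intermediate value theorem, be preceded by the value
        \<open>\<epsilon>\<close>, that is by a member of \<open>S\<close> smaller than
        \<open>m\<close>.\<close>
      have below: "d \<sigma> \<le> \<epsilon>" if "\<sigma> \<in> {0..m}" for \<sigma>
      proof (rule ccontr)
        assume "\<not> d \<sigma> \<le> \<epsilon>"
        moreover have "\<exists>y\<ge>0. y \<le> \<sigma> \<and> d y = \<epsilon>"
          by (rule IVT') (use d0 \<epsilon>(1) that m01 \<open>\<not> d \<sigma> \<le> \<epsilon>\<close> in \<open>auto intro: continuous_on_subset[OF d_cont]\<close>)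
        then obtain y where y: "0 \<le> y" "y \<le> \<sigma>" "d y = \<epsilon>" by blast
        then have "m \<le> y"
          using m01 that by (intro m(2)) (auto simp: S_def)
        then have "y = \<sigma>" using y that by auto
        ultimately show False using y by simp
      qed
      have "norm (?x (\<rho> m) - ?x (tn n)) \<le> B * \<bar>\<rho> m - tn n\<bar>"
      proof (rule solution_increment_le[OF x tn(1)])
        show "0 \<le> \<rho> m" using seg0 \<rho>_seg m01 by blast
        fix r assume "r \<in> closed_segment (tn n) (\<rho> m)"
        then obtain \<tau> where \<tau>: "0 \<le> \<tau>" "\<tau> \<le> 1" "r = (1 - \<tau>) *\<^sub>R tn n + \<tau> *\<^sub>R \<rho> m"
          by (auto simp: in_segment)
        then have r: "r = \<rho> (\<tau> * m)" and \<tau>m: "\<tau> * m \<in> {0..m}"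
          using m01 by (auto simp: \<rho>_def algebra_simps mult_left_le_one_le)
        have "\<tau> * m \<in> {0..1}"
          using \<tau>m m01 by auto
        then show "norm (rhs r (?x r)) \<le> B"
          using below[OF \<tau>m] seg0[OF \<rho>_seg] unfolding r by (intro rhs_le) (auto simp: d_def)
      qed
      also have "\<bar>\<rho> m - tn n\<bar> \<le> \<bar>t - tn n\<bar>"
        using m01 by (simp add: \<rho>_def abs_mult mult_left_le_one_le)
      also have "B * \<bar>t - tn n\<bar> \<le> \<epsilon> / 2"
        using elim(1) \<open>B > 0\<close> by (simp add: dist_real_def abs_minus_commute field_simps)
      finally have "norm (?x (\<rho> m) - vn n) \<le> \<epsilon> / 2"
        using tn(1) \<open>B > 0\<close> by (simp add: U_refl)
      then have "d m < \<epsilon>"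
        using elim(2) norm_triangle_ineq[of "?x (\<rho> m) - vn n" "vn n - v"] by (simp add: d_def dist_norm)
      then show False using m01 by simp
    qed
    then show ?case
      using \<epsilon>(2) by (simp add: d_def \<rho>_def dist_norm)
  qed
  then show "\<exists>N. \<forall>n\<ge>N. dist (U t (tn n) (vn n)) v < e"
    by (simp add: eventually_sequentially)
qed

lemma sum_P_apply:
  assumes "0 \<le> t"
  shows "(\<Sum>k\<in>Ks \<union> Ku. blinfun_apply (P k t) x) + (\<Sum>k\<in>Kc. blinfun_apply (P k t) x) = x"
proof -
  have "(\<Sum>k\<in>Ks \<union> Ku. blinfun_apply (P k t) x) + (\<Sum>k\<in>Kc. blinfun_apply (P k t) x)
      = (\<Sum>k\<in>Ks \<union> Ku \<union> Kc. blinfun_apply (P k t) x)"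
    using K_fin Kc_fin Kc_disj by (intro sum.union_disjoint[symmetric]) auto
  also have "\<dots> = blinfun_apply (\<Sum>k\<in>Ks \<union> Ku \<union> Kc. P k t) x"
    by (simp only: blinfun.sum_left)
  finally show ?thesis
    using P_sum[OF assms] by simp
qed

lemma f_eq_if_center_vanishes:
  assumes "center_vanishes Kc P f" "0 \<le> t"
  shows "(\<Sum>k\<in>Ks \<union> Ku. blinfun_apply (P k t) (f t x)) = f t x"
    and "(\<Sum>k\<in>Kc. blinfun_apply (P k t) (f t x)) = 0"
proof -
  show c: "(\<Sum>k\<in>Kc. blinfun_apply (P k t) (f t x)) = 0"
    using assms by (intro sum.neutral) (auto simp: center_vanishes_def)
  show "(\<Sum>k\<in>Ks \<union> Ku. blinfun_apply (P k t) (f t x)) = f t x"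
    using sum_P_apply[OF assms(2), of "f t x"] c by simp
qed

text \<open>\<open>\<parallel>P\<^sup>k\<parallel> \<mu>\<^sup>k\<close> is a locally integrable Lipschitz constant of \<open>P\<^sup>k f = P\<^sup>k P\<^sup>k f\<close>, so Gronwall's
  inequality applies.\<close>

lemma U_continuous_if_center_vanishes:
  assumes cv: "center_vanishes Kc P f" and ts: "0 \<le> t" "0 \<le> s"
  shows "continuous_on UNIV (U t s)"
proof -
  \<comment> \<open>An interval containing both times, since the two-sided Gronwall estimate covers
    \<open>t < s\<close> as well.\<close>
  define N where "N = max t s"
  have N: "0 \<le> N" using ts by (simp add: N_def)
  \<comment> \<open>A Lipschitz constant of \<open>rhs r\<close>; its primitive \<open>L\<close> is
    the function handed to \<open>gronwall_two_sided\<close>.\<close>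
  define l where "l r = norm (A r) + (\<Sum>k\<in>Ks \<union> Ku. norm (P k r) * \<mu> k r)" for r
  have l: "l integrable_on {0..N}"
    unfolding l_def
    by (intro integrable_add integrable_sum P_locally_integrable knorm_\<mu> \<mu>_meas \<mu>_nonneg K_fin N
        integrable_continuous_interval continuous_on_norm continuous_on_subset[OF A_cont]) auto
  define L where "L q = integral {0..q} l" for q
  have f_diff: "norm (f r x - f r y) \<le> (\<Sum>k\<in>Ks \<union> Ku. norm (P k r) * \<mu> k r) * norm (x - y)" if r: "0 \<le> r" for r x y
  proof -
    have "f r x - f r y = (\<Sum>k\<in>Ks \<union> Ku. blinfun_apply (P k r) (f r x) - blinfun_apply (P k r) (f r y))"
      using f_eq_if_center_vanishes(1)[OF cv r] by (simp add: sum_subtractf)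
    also have "norm \<dots> \<le> (\<Sum>k\<in>Ks \<union> Ku. (norm (P k r) * \<mu> k r) * norm (x - y))"
    proof (rule sum_norm_le)
      fix k assume k: "k \<in> Ks \<union> Ku"
      let ?d = "blinfun_apply (P k r) (f r x) - blinfun_apply (P k r) (f r y)"
      have "norm (blinfun_apply (P k r) ?d) \<le> norm (P k r) * norm ?d"
        by (rule norm_blinfun)
      also have "\<dots> \<le> norm (P k r) * (\<mu> k r * norm (x - y))"
        using k r by (intro mult_left_mono f_lip) auto
      finally show "norm ?d \<le> (norm (P k r) * \<mu> k r) * norm (x - y)"
        using k r by (simp add: blinfun.diff_right P_idem mult.assoc)
    qed
    finally show ?thesis by (simp add: sum_distrib_right)
  qed
  have "continuous_on {0..N} L"
    unfolding L_def by (rule indefinite_integral_continuous_1[OF l])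
  from gronwall_two_sided[OF this, where ?'a='a] obtain C where C: "C > 0"
    "\<And>x::real \<Rightarrow> 'a. continuous_on {0..N} x \<Longrightarrow>
      (\<forall>s t B. 0 \<le> s \<longrightarrow> s \<le> t \<longrightarrow> t \<le> N \<longrightarrow> (\<forall>r\<in>{s..t}. norm (x r) \<le> B)
        \<longrightarrow> norm (x t - x s) \<le> (L t - L s) * B) \<Longrightarrow>
      (\<forall>s\<in>{0..N}. \<forall>t\<in>{0..N}. norm (x t) \<le> C * norm (x s))"
    by blast
  have "norm (U t s v - U t s w) \<le> C * norm (v - w)" for v w
  proof -
    let ?d = "\<lambda>r. U r s v - U r s w"
    have "\<forall>p\<in>{0..N}. \<forall>q\<in>{0..N}. norm (?d q) \<le> C * norm (?d p)"
    proof (rule C(2))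
      show "continuous_on {0..N} ?d"
        using ts by (intro continuous_on_diff continuous_on_subset[OF U_continuous_time]) auto
      show "\<forall>p q B. 0 \<le> p \<longrightarrow> p \<le> q \<longrightarrow> q \<le> N \<longrightarrow> (\<forall>r\<in>{p..q}. norm (?d r) \<le> B)
        \<longrightarrow> norm (?d q - ?d p) \<le> (L q - L p) * B"
      proof (intro allI impI)
        fix p q B assume pq: "0 \<le> p" "p \<le> q" "q \<le> N" and B: "\<forall>r\<in>{p..q}. norm (?d r) \<le> B"
        have l0q: "l integrable_on {0..q}" and lpq: "l integrable_on {p..q}"
          by (rule integrable_on_subinterval[OF l]; use pq in auto)+
        have int: "((\<lambda>r. rhs r (U r s v) - rhs r (U r s w)) has_integral
            (U q s v - U p s v) - (U q s w - U p s w)) {p..q}"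
          using ts pq by (intro has_integral_diff classical_solution_has_integral[OF U_solution])
        have "norm (integral {p..q} (\<lambda>r. rhs r (U r s v) - rhs r (U r s w))) \<le> integral {p..q} (\<lambda>r. l r * B)"
        proof (rule integral_norm_bound_integral[OF has_integral_integrable[OF int] integrable_on_mult_left[OF lpq]])
          fix r assume r: "r \<in> {p..q}"
          then have r0: "0 \<le> r" using pq by simp
          have l0: "0 \<le> l r"
            unfolding l_def using r0 by (intro add_nonneg_nonneg sum_nonneg mult_nonneg_nonneg \<mu>_nonneg) auto
          have "rhs r (U r s v) - rhs r (U r s w) = blinfun_apply (A r) (?d r) + (f r (U r s v) - f r (U r s w))"
            by (simp add: blinfun.diff_right)
          also have "norm \<dots> \<le> norm (A r) * norm (?d r) + (\<Sum>k\<in>Ks \<union> Ku. norm (P k r) * \<mu> k r) * norm (?d r)"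
            by (intro norm_triangle_mono norm_blinfun f_diff r0)
          also have "\<dots> = l r * norm (?d r)"
            by (simp add: l_def algebra_simps)
          also have "\<dots> \<le> l r * B"
            using B r l0 by (intro mult_left_mono) auto
          finally show "norm (rhs r (U r s v) - rhs r (U r s w)) \<le> l r * B" .
        qed
        moreover have "integral {p..q} (\<lambda>r. l r * B) = (L q - L p) * B"
          using Henstock_Kurzweil_Integration.integral_combine[OF pq(1,2) l0q] by (simp add: L_def)
        moreover have "integral {p..q} (\<lambda>r. rhs r (U r s v) - rhs r (U r s w)) = ?d q - ?d p"
          unfolding integral_unique[OF int] by (simp add: algebra_simps)
        ultimately show "norm (?d q - ?d p) \<le> (L q - L p) * B"
          by (simp only:)
      qed
    qed
    moreover have "t \<in> {0..N}" "s \<in> {0..N}" using ts by (auto simp: N_def)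
    ultimately show ?thesis
      using ts by (metis U_refl)
  qed
  then have "C-lipschitz_on UNIV (U t s)"
    using C(1) by (auto simp: lipschitz_on_def dist_norm)
  then show ?thesis
    by (rule lipschitz_on_continuous_on)
qed

text \<open>By uniqueness the trajectory through \<open>(t, y t)\<close> is \<open>y\<close>, so a
  formula defined pointwise by the trajectory through \<open>(t, v)\<close> becomes, along a
  solution, a formula in one single curve.\<close>

lemma green_pullback:
  assumes y: "classical_solution rhs y" and t: "0 \<le> t"
  shows "green (\<lambda>s. U s t (y t)) t = green y t"
  by (rule green_cong[OF solution_eq_U[OF y t, symmetric] t])

text \<open>\<open>green_tendsto\<close> asks only for pointwise convergence of the trajectories.
  Passing through the limit time, \<open>U s tn vn\<close> is \<open>U s t (U t tn vn)\<close>: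
  \<open>U_tendsto_diagonal\<close> treats the inner map and the hypothesis the outer one.\<close>

lemma conjugacy_continuous:
  assumes U_cont: "\<And>t s. 0 \<le> t \<Longrightarrow> 0 \<le> s \<Longrightarrow> continuous_on UNIV (U t s)"
  shows "continuous_on ({0..} \<times> UNIV) (\<lambda>(t, v). v - green (\<lambda>s. U s t v) t)"
  unfolding continuous_on_sequentially comp_def
proof (intro allI ballI impI, elim conjE)
  fix x :: "nat \<Rightarrow> real \<times> 'a" and a
  assume a: "a \<in> {0..} \<times> UNIV" and xn: "\<forall>n. x n \<in> {0..} \<times> UNIV" and x: "x \<longlonglongrightarrow> a"
  have a0: "0 \<le> fst a" and x0: "\<And>n. 0 \<le> fst (x n)"
    using a xn by (auto simp: mem_Times_iff)
  have "(\<lambda>n. green (\<lambda>s. U s (fst (x n)) (snd (x n))) (fst (x n))) \<longlonglongrightarrow> green (\<lambda>s. U s (fst a) (snd a)) (fst a)"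
  proof (rule green_tendsto)
    show "(\<lambda>n. U s (fst (x n)) (snd (x n))) \<longlonglongrightarrow> U s (fst a) (snd a)" if s: "0 \<le> s" for s
    proof -
      have "(\<lambda>n. U (fst a) (fst (x n)) (snd (x n))) \<longlonglongrightarrow> snd a"
        by (intro U_tendsto_diagonal a0 x0 tendsto_fst tendsto_snd x)
      then have "(\<lambda>n. U s (fst a) (U (fst a) (fst (x n)) (snd (x n)))) \<longlonglongrightarrow> U s (fst a) (snd a)"
        by (rule continuous_on_tendsto_compose[OF U_cont[OF s a0]]) auto
      then show ?thesis
        using s a0 x0 by (simp add: U_apply_U)
    qed
  qed (auto intro!: U_continuous_time a0 x0 tendsto_fst x)
  then have "(\<lambda>n. snd (x n) - green (\<lambda>s. U s (fst (x n)) (snd (x n))) (fst (x n)))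
      \<longlonglongrightarrow> snd a - green (\<lambda>s. U s (fst a) (snd a)) (fst a)"
    by (intro tendsto_diff tendsto_snd x)
  then show "(\<lambda>n. case x n of (t, v) \<Rightarrow> v - green (\<lambda>s. U s t v) t)
      \<longlonglongrightarrow> (case a of (t, v) \<Rightarrow> v - green (\<lambda>s. U s t v) t)"
    by (simp add: split_beta)
qed

section \<open>The equations satisfied by the transformed curves\<close>

lemma norm_A_integrable:
  assumes "continuous_on {0..} z" "0 \<le> N"
  shows "(\<lambda>r. norm (blinfun_apply (A r) (z r))) integrable_on {0..N}"
  by (intro integrable_continuous_interval continuous_on_norm blinfun.continuous_on
      continuous_on_subset[OF A_cont] continuous_on_subset[OF assms(1)]) auto

text \<open>The linear equation for \<open>x\<close> is added to the equation for
  \<open>green z\<close>. The integral identity is a conclusion of its own because, once the sum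
  equals \<open>f\<close>, it yields a classical solution.\<close>

lemma perturbed_solution:
  assumes x: "classical_solution (\<lambda>t v. blinfun_apply (A t) v) x"
    and z: "continuous_on {0..} z" "\<And>t. 0 \<le> t \<Longrightarrow> z t = x t + green z t"
  shows "\<And>s t. 0 \<le> s \<Longrightarrow> s \<le> t \<Longrightarrow>
      ((\<lambda>r. blinfun_apply (A r) (z r) + (\<Sum>k\<in>Ks \<union> Ku. blinfun_apply (P k r) (f r (z r)))) has_integral (z t - z s)) {s..t}"
    and "caratheodory_solution (\<lambda>t v. blinfun_apply (A t) v + (\<Sum>k\<in>Ks \<union> Ku. blinfun_apply (P k t) (f t v))) z"
proof -
  show int: "((\<lambda>r. blinfun_apply (A r) (z r) + (\<Sum>k\<in>Ks \<union> Ku. blinfun_apply (P k r) (f r (z r)))) has_integral (z t - z s)) {s..t}"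
    if st: "0 \<le> s" "s \<le> t" for s t
  proof -
    have "((\<lambda>r. blinfun_apply (A r) (x r) + (blinfun_apply (A r) (green z r) + (\<Sum>k\<in>Ks \<union> Ku. force k z r)))
        has_integral (x t - x s) + (green z t - green z s)) {s..t}"
      by (intro has_integral_add classical_solution_has_integral[OF x] green_solution(2)[OF z(1)] st)
    moreover have "blinfun_apply (A r) (x r) + (blinfun_apply (A r) (green z r) + (\<Sum>k\<in>Ks \<union> Ku. force k z r))
        = blinfun_apply (A r) (z r) + (\<Sum>k\<in>Ks \<union> Ku. blinfun_apply (P k r) (f r (z r)))" if "r \<in> {s..t}" for r
      using that st z(2)[of r] by (simp add: force_def blinfun.add_right)
    ultimately have "((\<lambda>r. blinfun_apply (A r) (z r) + (\<Sum>k\<in>Ks \<union> Ku. blinfun_apply (P k r) (f r (z r))))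
        has_integral (x t - x s) + (green z t - green z s)) {s..t}"
      by (rule has_integral_eq[rotated])
    moreover have "(x t - x s) + (green z t - green z s) = z t - z s"
      using z(2)[of t] z(2)[of s] st by simp
    ultimately show ?thesis by simp
  qed
  show "caratheodory_solution (\<lambda>t v. blinfun_apply (A t) v + (\<Sum>k\<in>Ks \<union> Ku. blinfun_apply (P k t) (f t v))) z"
  proof (rule caratheodory_solutionI[OF z(1), where h="\<lambda>r. norm (blinfun_apply (A r) (z r)) + majorant r"])
    show "strongly_measurable (lebesgue_on {0..}) (\<lambda>r. blinfun_apply (A r) (z r) + (\<Sum>k\<in>Ks \<union> Ku. blinfun_apply (P k r) (f r (z r))))"
      by (rule strongly_measurable_add[OF _ sum_force_measurable[OF z(1), unfolded force_def]])
        (intro strongly_measurable_continuous_on_atLeast blinfun.continuous_on A_cont z(1))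
    show "(\<lambda>r. norm (blinfun_apply (A r) (z r)) + majorant r) integrable_on {0..N}" if "0 \<le> N" for N
      by (intro integrable_add norm_A_integrable z(1) majorant_integrable that)
    show "norm (blinfun_apply (A r) (z r) + (\<Sum>k\<in>Ks \<union> Ku. blinfun_apply (P k r) (f r (z r))))
        \<le> norm (blinfun_apply (A r) (z r)) + majorant r" if "0 \<le> r" for r
      using norm_sum_force_le[OF that, of z] unfolding force_def by (intro norm_triangle_mono) auto
  qed (rule int)
qed

text \<open>Subtracting the equation for \<open>green y\<close> removes the stable and unstable
  forces from \<open>f\<close>; as the projections sum to the identity, the central forces evaluated
  along \<open>y\<close> remain.\<close>

lemma center_solution:
  assumes y: "classical_solution rhs y" and z: "\<And>t. 0 \<le> t \<Longrightarrow> z t = y t - green y t"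
  shows "continuous_on {0..} z"
    and "\<And>s t. 0 \<le> s \<Longrightarrow> s \<le> t \<Longrightarrow>
      ((\<lambda>r. blinfun_apply (A r) (z r) + (\<Sum>k\<in>Kc. blinfun_apply (P k r) (f r (y r)))) has_integral (z t - z s)) {s..t}"
    and "caratheodory_solution (\<lambda>t v. blinfun_apply (A t) v + (\<Sum>k\<in>Kc. blinfun_apply (P k t) (f t (y t)))) z"
proof -
  have y_cont: "continuous_on {0..} y"
    using y by (rule classical_solution_continuous)
  have "continuous_on {0..} (\<lambda>t. y t - green y t)"
    by (intro continuous_on_diff y_cont green_solution)
  then show z_cont: "continuous_on {0..} z"
    by (rule continuous_on_cong[THEN iffD1, rotated 2]) (auto simp: z)
  show int: "((\<lambda>r. blinfun_apply (A r) (z r) + (\<Sum>k\<in>Kc. blinfun_apply (P k r) (f r (y r)))) has_integral (z t - z s)) {s..t}"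
    if st: "0 \<le> s" "s \<le> t" for s t
  proof -
    have "((\<lambda>r. rhs r (y r) - (blinfun_apply (A r) (green y r) + (\<Sum>k\<in>Ks \<union> Ku. force k y r)))
        has_integral (y t - y s) - (green y t - green y s)) {s..t}"
      by (intro has_integral_diff classical_solution_has_integral[OF y] green_solution(2)[OF y_cont] st)
    moreover have "rhs r (y r) - (blinfun_apply (A r) (green y r) + (\<Sum>k\<in>Ks \<union> Ku. force k y r))
        = blinfun_apply (A r) (z r) + (\<Sum>k\<in>Kc. blinfun_apply (P k r) (f r (y r)))" if "r \<in> {s..t}" for r
      using that st sum_P_apply[of r "f r (y r)"]
      by (simp add: z force_def blinfun.diff_right algebra_simps)
    ultimately have "((\<lambda>r. blinfun_apply (A r) (z r) + (\<Sum>k\<in>Kc. blinfun_apply (P k r) (f r (y r))))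
        has_integral (y t - y s) - (green y t - green y s)) {s..t}"
      by (rule has_integral_eq[rotated])
    moreover have "(y t - y s) - (green y t - green y s) = z t - z s"
      using z[of t] z[of s] st by simp
    ultimately show ?thesis by simp
  qed
  show "caratheodory_solution (\<lambda>t v. blinfun_apply (A t) v + (\<Sum>k\<in>Kc. blinfun_apply (P k t) (f t (y t)))) z"
  proof (rule caratheodory_solutionI[OF z_cont, where h="\<lambda>r. norm (blinfun_apply (A r) (z r)) + (norm (f r (y r)) + majorant r)"])
    show "strongly_measurable (lebesgue_on {0..}) (\<lambda>r. blinfun_apply (A r) (z r) + (\<Sum>k\<in>Kc. blinfun_apply (P k r) (f r (y r))))"
      by (intro strongly_measurable_add strongly_measurable_sum strongly_measurable_blinfun_apply Pc_meas
          strongly_measurable_continuous_on_atLeast A_cont z_cont f_comp_continuous y_cont)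
    show "(\<lambda>r. norm (blinfun_apply (A r) (z r)) + (norm (f r (y r)) + majorant r)) integrable_on {0..N}" if "0 \<le> N" for N
      by (intro integrable_add norm_A_integrable z_cont majorant_integrable that integrable_continuous_interval
          continuous_on_norm continuous_on_subset[OF f_comp_continuous[OF y_cont]]) auto
    show "norm (blinfun_apply (A r) (z r) + (\<Sum>k\<in>Kc. blinfun_apply (P k r) (f r (y r))))
        \<le> norm (blinfun_apply (A r) (z r)) + (norm (f r (y r)) + majorant r)" if r: "0 \<le> r" for r
    proof -
      \<comment> \<open>The central projections carry no norm bound, so the central force is
        estimated as \<open>f\<close> minus the other forces.\<close>
      have "(\<Sum>k\<in>Kc. blinfun_apply (P k r) (f r (y r))) = f r (y r) - (\<Sum>k\<in>Ks \<union> Ku. force k y r)"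
        using sum_P_apply[OF r, of "f r (y r)"] by (simp add: force_def algebra_simps)
      also have "norm \<dots> \<le> norm (f r (y r)) + majorant r"
        using norm_triangle_ineq4 norm_sum_force_le[OF r, of y] by (meson add_left_mono order_trans)
      finally show ?thesis by (intro norm_triangle_mono) auto
    qed
  qed (rule int)
qed

text \<open>\<open>y\<close> and \<open>w\<close> may be unbounded, but their difference equals
  \<open>green y - green w\<close> and is bounded by \<open>2 * D\<close>. Iterating the contraction
  from this bound drives the difference to zero.\<close>

lemma green_injective:
  assumes y: "continuous_on {0..} y" and w: "continuous_on {0..} w"
    and eq: "\<And>t. 0 \<le> t \<Longrightarrow> y t - green y t = w t - green w t" and t: "0 \<le> t"
  shows "y t = w t"
proof -
  obtain D where D: "D \<ge> 0" "\<And>c t. continuous_on {0..} c \<Longrightarrow> 0 \<le> t \<Longrightarrow> norm (green c t) \<le> D"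
    using green_bounded by blast
  let ?L = "\<Sum>k\<in>Ks \<union> Ku. lam k"
  have L: "0 \<le> ?L" using lam_pos by (intro sum_nonneg) (auto intro: less_imp_le)
  have diff: "y s - w s = green y s - green w s" if "0 \<le> s" for s
    using eq[OF that] by (simp add: algebra_simps)
  have "\<forall>s\<ge>0. norm (y s - w s) \<le> ?L ^ n * (2 * D)" for n
  proof (induction n)
    case 0
    show ?case
    proof (intro allI impI)
      fix s :: real assume s: "0 \<le> s"
      show "norm (y s - w s) \<le> ?L ^ 0 * (2 * D)"
        using norm_triangle_ineq4[of "green y s" "green w s"] D(2)[OF y s] D(2)[OF w s] diff[OF s] by simp
    qed
  next
    case (Suc n)
    show ?case
      using green_contraction[OF y w, of _ "?L ^ n * (2 * D)"] Suc diff by (auto simp: mult.assoc)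
  qed
  then have le: "norm (y t - w t) \<le> ?L ^ n * (2 * D)" for n
    using t by blast
  have "(\<lambda>n. ?L ^ n * (2 * D)) \<longlonglongrightarrow> 0 * (2 * D)"
    using L lam_sum by (intro tendsto_mult LIMSEQ_realpow_zero tendsto_const)
  then have "norm (y t - w t) \<le> 0"
    using le by (intro LIMSEQ_le_const) auto
  then show ?thesis by simp
qed

end

text \<open>Continuity of \<open>Hbar\<close> is stated for a vanishing central part or for
  continuous maps \<open>U t s\<close>, because \<open>Hbar t v\<close> depends on the whole
  trajectory through \<open>(t, v)\<close>. Deriving continuous dependence from uniqueness usually
  relies on compactness of families of solutions, which a general Banach space does not provide;
  with a vanishing central part it follows from Gronwall.\<close>

theorem theorem2:
  fixes A :: "real \<Rightarrow> 'a::banach \<Rightarrow>\<^sub>L 'a"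
    and f :: "real \<Rightarrow> 'a \<Rightarrow> 'a"
    and T :: "real \<Rightarrow> real \<Rightarrow> 'a \<Rightarrow>\<^sub>L 'a"
    and U :: "real \<Rightarrow> real \<Rightarrow> 'a \<Rightarrow> 'a"
    and K Ks Ku Kc :: "'k set"
    and P :: "'k \<Rightarrow> real \<Rightarrow> 'a \<Rightarrow>\<^sub>L 'a"
    and \<mu> \<nu> :: "'k \<Rightarrow> real \<Rightarrow> real"
    and lam :: "'k \<Rightarrow> real"
  assumes A_cont: "continuous_on {0..} A"
    and f_cont: "continuous_on ({0..} \<times> UNIV) (\<lambda>(t, x). f t x)"
    and T: "evolution_family (\<lambda>t x. blinfun_apply (A t) x) (\<lambda>t s v. blinfun_apply (T t s) v)"
    and U: "evolution_family (\<lambda>t x. blinfun_apply (A t) x + f t x) U"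
    and K_fin: "finite K"
    and K_eq: "K = Ks \<union> Ku \<union> Kc"
    and K_disj: "Ks \<inter> Ku = {}" "Ks \<inter> Kc = {}" "Ku \<inter> Kc = {}"
    and P_proj: "\<And>k t. k \<in> K \<Longrightarrow> 0 \<le> t \<Longrightarrow> P k t o\<^sub>L P k t = P k t"
    and P_sum: "\<And>t. 0 \<le> t \<Longrightarrow> (\<Sum>k\<in>K. P k t) = id_blinfun"
    and P_orth: "\<And>k l t. k \<in> K \<Longrightarrow> l \<in> K \<Longrightarrow> k \<noteq> l \<Longrightarrow> 0 \<le> t \<Longrightarrow> P k t o\<^sub>L P l t = 0"
    and P_meas: "\<And>k. k \<in> K \<Longrightarrow> strongly_measurable (lebesgue_on {0..}) (P k)"
    and \<mu>_meas: "\<And>k. k \<in> Ks \<union> Ku \<Longrightarrow> \<mu> k \<in> borel_measurable (restrict_space borel {0..})"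
    and \<nu>_meas: "\<And>k. k \<in> Ks \<union> Ku \<Longrightarrow> \<nu> k \<in> borel_measurable (restrict_space borel {0..})"
    and \<mu>_nonneg: "\<And>k t. k \<in> Ks \<union> Ku \<Longrightarrow> 0 \<le> t \<Longrightarrow> 0 \<le> \<mu> k t"
    and \<nu>_nonneg: "\<And>k t. k \<in> Ks \<union> Ku \<Longrightarrow> 0 \<le> t \<Longrightarrow> 0 \<le> \<nu> k t"
    and lam_pos: "\<And>k. k \<in> Ks \<union> Ku \<Longrightarrow> 0 < lam k"
    and stable_\<nu>: "\<And>k. k \<in> Ks \<Longrightarrow>
      (SUP t\<in>{0..}. \<integral>\<^sup>+s\<in>{0..t}. ennreal (norm (T t s o\<^sub>L P k s) * \<nu> k s) \<partial>lebesgue) < \<infinity>"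
    and stable_\<mu>: "\<And>k. k \<in> Ks \<Longrightarrow>
      (SUP t\<in>{0..}. \<integral>\<^sup>+s\<in>{0..t}. ennreal (norm (T t s o\<^sub>L P k s) * \<mu> k s) \<partial>lebesgue)
        \<le> ennreal (lam k)"
    and unstable_\<nu>: "\<And>k. k \<in> Ku \<Longrightarrow>
      (SUP t\<in>{0..}. \<integral>\<^sup>+s\<in>{t..}. ennreal (norm (T t s o\<^sub>L P k s) * \<nu> k s) \<partial>lebesgue) < \<infinity>"
    and unstable_\<mu>: "\<And>k. k \<in> Ku \<Longrightarrow>
      (SUP t\<in>{0..}. \<integral>\<^sup>+s\<in>{t..}. ennreal (norm (T t s o\<^sub>L P k s) * \<mu> k s) \<partial>lebesgue)
        \<le> ennreal (lam k)"
    and f_bound: "\<And>k t. k \<in> Ks \<union> Ku \<Longrightarrow> 0 \<le> t \<Longrightarrow>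
      sup_norm (\<lambda>x. blinfun_apply (P k t) (f t x)) \<le> ennreal (\<nu> k t)"
    and f_lip: "\<And>k t x y. k \<in> Ks \<union> Ku \<Longrightarrow> 0 \<le> t \<Longrightarrow>
      norm (blinfun_apply (P k t) (f t x) - blinfun_apply (P k t) (f t y)) \<le> \<mu> k t * norm (x - y)"
    and lam_sum: "(\<Sum>k\<in>Ks \<union> Ku. lam k) < 1"
  shows "\<exists>H Hbar :: real \<Rightarrow> 'a \<Rightarrow> 'a.
      continuous_on ({0..} \<times> UNIV) (\<lambda>(t, x). H t x)
    \<and> (\<forall>x. classical_solution (\<lambda>t v. blinfun_apply (A t) v) x \<longrightarrow>
          caratheodory_solution
            (\<lambda>t v. blinfun_apply (A t) v + (\<Sum>k\<in>Ks \<union> Ku. blinfun_apply (P k t) (f t v)))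
            (\<lambda>t. H t (x t)))
    \<and> (center_vanishes Kc P f \<or> (\<forall>t\<ge>0. \<forall>s\<ge>0. continuous_on UNIV (U t s)) \<longrightarrow>
          continuous_on ({0..} \<times> UNIV) (\<lambda>(t, x). Hbar t x))
    \<and> (\<forall>y. classical_solution (\<lambda>t v. blinfun_apply (A t) v + f t v) y \<longrightarrow>
          caratheodory_solution
            (\<lambda>t v. blinfun_apply (A t) v + (\<Sum>k\<in>Kc. blinfun_apply (P k t) (f t (y t))))
            (\<lambda>t. Hbar t (y t)))
    \<and> (SUP t\<in>{0..}. sup_norm (\<lambda>x. H t x - x)) < \<infinity>
    \<and> (SUP t\<in>{0..}. sup_norm (\<lambda>x. Hbar t x - x)) < \<infinity>
    \<and> (center_vanishes Kc P f \<longrightarrow>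
          (\<forall>t\<ge>0. homeomorphic_map euclidean euclidean (H t)
               \<and> homeomorphic_map euclidean euclidean (Hbar t)
               \<and> (\<forall>x. H t (Hbar t x) = x \<and> Hbar t (H t x) = x))
        \<and> (\<forall>t\<ge>0. \<forall>s\<ge>0. \<forall>x.
               H t (blinfun_apply (T t s) x) = U t s (H s x)
             \<and> Hbar t (U t s x) = blinfun_apply (T t s) (Hbar s x)))"
proof -
  interpret flow: trichotomy_flow A T f Ks Ku P \<mu> \<nu> lam U Kc
  proof
    show "finite (Ks \<union> Ku)" "finite Kc"
      using K_fin K_eq by auto
    show "(Ks \<union> Ku) \<inter> Kc = {}"
      using K_disj by auto
    show "(\<Sum>k\<in>Ks \<union> Ku \<union> Kc. P k t) = id_blinfun" if "0 \<le> t" for t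
      using P_sum[OF that] K_eq by simp
  qed (fact A_cont f_cont T U K_disj \<mu>_meas \<nu>_meas \<mu>_nonneg \<nu>_nonneg lam_pos stable_\<nu> stable_\<mu>
      unstable_\<nu> unstable_\<mu> f_bound f_lip lam_sum | (use K_eq in \<open>auto intro!: P_proj P_meas\<close>)[1])+
  obtain \<eta> :: "(real \<times> 'a) \<Rightarrow>\<^sub>C 'a" where \<eta>: "\<And>t \<xi>. 0 \<le> t \<Longrightarrow>
      apply_bcontfun \<eta> (t, \<xi>) = flow.green (\<lambda>s. blinfun_apply (T s 0) \<xi> + apply_bcontfun \<eta> (s, \<xi>)) t"
    using flow.fixed_point by blast
  obtain D where D: "D \<ge> 0" "\<And>c t. continuous_on {0..} c \<Longrightarrow> 0 \<le> t \<Longrightarrow> norm (flow.green c t) \<le> D"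
    using flow.green_bounded by blast
  \<comment> \<open>\<open>\<eta>\<close> is indexed by initial values at time 0, so
    \<open>v\<close> is first carried back from time \<open>t\<close> by
    \<open>T 0 t\<close>.\<close>
  define H where "H t v = v + apply_bcontfun \<eta> (t, blinfun_apply (T 0 t) v)" for t v
  define Hbar where "Hbar t v = v - flow.green (\<lambda>s. U s t v) t" for t v

  have H_cont: "continuous_on ({0..} \<times> UNIV) (\<lambda>(t, x). H t x)"
  proof -
    have "continuous_on ({0..} \<times> UNIV)
        (\<lambda>z. snd z + apply_bcontfun \<eta> (fst z, blinfun_apply (T 0 (fst z)) (snd z)))"
      by (intro continuous_on_add continuous_on_compose2[OF continuous_on_apply_bcontfun[of UNIV]]
          continuous_on_Pair blinfun.continuous_on continuous_on_compose2[OF flow.T_continuous_snd]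
          continuous_on_fst continuous_on_snd continuous_on_id) auto
    then show ?thesis by (simp add: H_def split_beta)
  qed
  have Hbar_cont: "continuous_on ({0..} \<times> UNIV) (\<lambda>(t, x). Hbar t x)"
    if "center_vanishes Kc P f \<or> (\<forall>t\<ge>0. \<forall>s\<ge>0. continuous_on UNIV (U t s))"
    unfolding Hbar_def
    by (rule flow.conjugacy_continuous) (use that flow.U_continuous_if_center_vanishes in blast)
  have slice: "continuous_on UNIV (F t)"
    if "continuous_on ({0..} \<times> UNIV) (\<lambda>(t, x). F t x)" "0 \<le> t" for F :: "real \<Rightarrow> 'a \<Rightarrow> 'a" and t
  proof -
    have "continuous_on UNIV (\<lambda>x. case (t, x) of (t, x) \<Rightarrow> F t x)"
      by (rule continuous_on_compose2[OF that(1)]) (use that(2) in \<open>auto intro!: continuous_intros\<close>)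
    then show ?thesis by simp
  qed

  have H_fixed: "continuous_on {0..} (\<lambda>t. H t (x t))"
    "\<And>t. 0 \<le> t \<Longrightarrow> H t (x t) = x t + flow.green (\<lambda>t. H t (x t)) t"
    if x: "classical_solution (\<lambda>t v. blinfun_apply (A t) v) x" for x
  proof -
    have "continuous_on {0..} (\<lambda>t. case (t, x t) of (t, v) \<Rightarrow> H t v)"
      by (rule continuous_on_compose2[OF H_cont])
        (auto intro!: continuous_intros classical_solution_continuous[OF x])
    then show "continuous_on {0..} (\<lambda>t. H t (x t))" by simp
    have xT: "x t = blinfun_apply (T t 0) (x 0)" if "0 \<le> t" for t
      by (rule flow.solution_eq_T[OF x order_refl that])
    \<comment> \<open>Along a linear solution the pulled-back initial value is always
      \<open>x 0\<close>, so the fixed-point equation with \<open>\<xi>\<close> equal to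
      \<open>x 0\<close> governs the whole curve.\<close>
    have Hx: "H t (x t) = blinfun_apply (T t 0) (x 0) + apply_bcontfun \<eta> (t, x 0)" if "0 \<le> t" for t
      using flow.solution_eq_T[OF x that order_refl] xT[OF that] by (simp add: H_def)
    show "H t (x t) = x t + flow.green (\<lambda>t. H t (x t)) t" if t: "0 \<le> t" for t
    proof -
      have "flow.green (\<lambda>t. H t (x t)) t
          = flow.green (\<lambda>s. blinfun_apply (T s 0) (x 0) + apply_bcontfun \<eta> (s, x 0)) t"
        by (rule flow.green_cong[OF Hx t])
      then show ?thesis
        by (simp add: Hx[OF t] \<eta>[OF t] xT[OF t, symmetric])
    qed
  qed
  have Hbar_eq: "Hbar t (y t) = y t - flow.green y t"
    if "classical_solution flow.rhs y" "0 \<le> t" for y t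
    unfolding Hbar_def using flow.green_pullback[OF that] by simp

  have H_bounded: "(SUP t\<in>{0..}. sup_norm (\<lambda>x. H t x - x)) < \<infinity>"
  proof -
    have "norm (H t x - x) \<le> norm \<eta>" for t x
      using norm_bounded[of \<eta>] by (simp add: H_def)
    then have "(SUP t\<in>{0..}. sup_norm (\<lambda>x. H t x - x)) \<le> ennreal (norm \<eta>)"
      unfolding sup_norm_def by (intro SUP_least ennreal_leI)
    then show ?thesis by (simp add: le_less_trans)
  qed
  have Hbar_bounded: "(SUP t\<in>{0..}. sup_norm (\<lambda>x. Hbar t x - x)) < \<infinity>"
  proof -
    have "norm (Hbar t x - x) \<le> D" if "0 \<le> t" for t x
      using D(2)[OF flow.U_continuous_time[OF that] that] by (simp add: Hbar_def)
    then have "(SUP t\<in>{0..}. sup_norm (\<lambda>x. Hbar t x - x)) \<le> ennreal D"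
      unfolding sup_norm_def by (intro SUP_least ennreal_leI) auto
    then show ?thesis by (simp add: le_less_trans)
  qed

  have conjugacy: "(\<forall>t\<ge>0. homeomorphic_map euclidean euclidean (H t)
               \<and> homeomorphic_map euclidean euclidean (Hbar t)
               \<and> (\<forall>x. H t (Hbar t x) = x \<and> Hbar t (H t x) = x))
        \<and> (\<forall>t\<ge>0. \<forall>s\<ge>0. \<forall>x.
               H t (blinfun_apply (T t s) x) = U t s (H s x)
             \<and> Hbar t (U t s x) = blinfun_apply (T t s) (Hbar s x))"
    if cv: "center_vanishes Kc P f"
  proof -
    have H_flow: "classical_solution flow.rhs (\<lambda>t. H t (x t))"
      if x: "classical_solution (\<lambda>t v. blinfun_apply (A t) v) x" for x
    proof (rule classical_solutionI)
      show "continuous_on {0..} (\<lambda>r. flow.rhs r (H r (x r)))"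
        by (intro continuous_on_add blinfun.continuous_on A_cont H_fixed x flow.f_comp_continuous)
      show "((\<lambda>r. flow.rhs r (H r (x r))) has_integral (H t (x t) - H s (x s))) {s..t}"
        if st: "0 \<le> s" "s \<le> t" for s t
        by (rule has_integral_eq[OF _ flow.perturbed_solution(1)[OF x H_fixed[OF x] st]])
          (use st in \<open>simp add: flow.f_eq_if_center_vanishes[OF cv]\<close>)
    qed
    have Hbar_flow: "classical_solution (\<lambda>t v. blinfun_apply (A t) v) (\<lambda>t. Hbar t (y t))"
      if y: "classical_solution flow.rhs y" for y
    proof (rule classical_solutionI)
      note z = flow.center_solution[OF y Hbar_eq[OF y]]
      show "continuous_on {0..} (\<lambda>r. blinfun_apply (A r) (Hbar r (y r)))"
        by (intro blinfun.continuous_on A_cont z(1))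
      show "((\<lambda>r. blinfun_apply (A r) (Hbar r (y r))) has_integral (Hbar t (y t) - Hbar s (y s))) {s..t}"
        if st: "0 \<le> s" "s \<le> t" for s t
        by (rule has_integral_eq[OF _ z(2)[OF _ st]])
          (use st in \<open>simp add: flow.f_eq_if_center_vanishes[OF cv]\<close>)
    qed
    \<comment> \<open>\<open>H\<close> along the linear trajectory through \<open>(s, x)\<close> is
      a nonlinear solution with value \<open>H s x\<close> at time \<open>s\<close>, so uniqueness
      identifies it. The identity for \<open>Hbar\<close> arises in the same way.\<close>
    have H_T: "H t (blinfun_apply (T t s) x) = U t s (H s x)" if ts: "0 \<le> t" "0 \<le> s" for t s x
      using flow.solution_eq_U[OF H_flow[OF flow.T_solution[OF ts(2), of x]] ts(2,1)] flow.T_refl[OF ts(2)]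
      by simp
    have Hbar_U: "Hbar t (U t s x) = blinfun_apply (T t s) (Hbar s x)" if ts: "0 \<le> t" "0 \<le> s" for t s x
      using flow.solution_eq_T[OF Hbar_flow[OF flow.U_solution[OF ts(2), of x]] ts(2,1)] flow.U_refl[OF ts(2)]
      by simp
    have H_Hbar: "H t (Hbar t x) = x" if t: "0 \<le> t" for t x
    proof -
      note y = flow.U_solution[OF t, of x]
      note w = H_fixed[OF Hbar_flow[OF y]]
      \<comment> \<open>The nonlinear trajectory \<open>y\<close> and its image under
        \<open>Hbar\<close> followed by \<open>H\<close> have the same value of
        \<open>c - green c\<close>, namely \<open>Hbar\<close> along \<open>y\<close>; injectivity
        of that map identifies them.\<close>
      have "U t t x = H t (Hbar t (U t t x))"
      proof (rule flow.green_injective[OF flow.U_continuous_time[OF t] w(1) _ t])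
        show "U r t x - flow.green (\<lambda>r. U r t x) r
            = H r (Hbar r (U r t x)) - flow.green (\<lambda>r. H r (Hbar r (U r t x))) r" if "0 \<le> r" for r
          unfolding w(2)[OF that] using Hbar_eq[OF y that] by simp
      qed
      then show ?thesis by (simp add: flow.U_refl t)
    qed
    have Hbar_H: "Hbar t (H t x) = x" if t: "0 \<le> t" for t x
    proof -
      note l = flow.T_solution[OF t, of x]
      \<comment> \<open>In this order the fixed-point equation suffices: the image of a linear
        solution under \<open>H\<close> is a nonlinear solution, and subtracting its
        \<open>green\<close> term returns the linear one.\<close>
      have "Hbar t (H t (blinfun_apply (T t t) x)) = blinfun_apply (T t t) x"
        using Hbar_eq[OF H_flow[OF l] t] H_fixed(2)[OF l t] by simp
      then show ?thesis by (simp add: flow.T_refl t)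
    qed
    have "homeomorphic_maps euclidean euclidean (H t) (Hbar t)" if t: "0 \<le> t" for t
      using slice[OF H_cont t] slice[OF Hbar_cont t] cv H_Hbar[OF t] Hbar_H[OF t]
      by (simp add: homeomorphic_maps_def)
    then show ?thesis
      using H_T Hbar_U H_Hbar Hbar_H
      by (metis homeomorphic_map_maps homeomorphic_maps_sym)
  qed

  show ?thesis
  proof (rule exI[of _ H], rule exI[of _ Hbar], intro conjI)
    show "\<forall>x. classical_solution (\<lambda>t v. blinfun_apply (A t) v) x \<longrightarrow>
          caratheodory_solution
            (\<lambda>t v. blinfun_apply (A t) v + (\<Sum>k\<in>Ks \<union> Ku. blinfun_apply (P k t) (f t v)))
            (\<lambda>t. H t (x t))"
      by (intro allI impI, rule flow.perturbed_solution(2)[OF _ H_fixed])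
    show "\<forall>y. classical_solution flow.rhs y \<longrightarrow>
          caratheodory_solution
            (\<lambda>t v. blinfun_apply (A t) v + (\<Sum>k\<in>Kc. blinfun_apply (P k t) (f t (y t))))
            (\<lambda>t. Hbar t (y t))"
      by (intro allI impI, rule flow.center_solution(3)[OF _ Hbar_eq])
  qed (fact H_cont H_bounded Hbar_bounded | rule impI, erule Hbar_cont conjugacy)+
qed

end
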